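(* Let $G$ be a connected 4-regular graph and let $v,w$ be adjacent vertices of $G$ such that the neighbours of $w$ are exactly $v,a,b,c$ and the neighbours of $v$ are exactly $w,d,e,f$, where $a,b,c,d,e,f$ are distinct. Let $R=G-\{v,w\}$. Then there is a fixed-point free involution on \[ \mathcal{R}_{\{a\},\{b,c,d,e,f\}} \cup \mathcal{R}_{\{b\},\{a,c,d,e,f\}} \cup \mathcal{R}_{\{c\},\{a,b,d,e,f\}} \cup \mathcal{R}_{\{d\},\{a,b,c,e,f\}} \cup \mathcal{R}_{\{e\},\{a,b,c,d,f\}} \cup \mathcal{R}_{\{f\},\{a,b,c,d,e\}}, \] and thus \[ r_{\{a\},\{b,c,d,e,f\}} + r_{\{b\},\{a,c,d,e,f\}} + r_{\{c\},\{a,b,d,e,f\}} + r_{\{d\},\{a,b,c,e,f\}} + r_{\{e\},\{a,b,c,d,f\}} + r_{\{f\},\{a,b,c,d,e\}} \equiv 0 \pmod 2. \]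
   Context: $G-\{v,w\}$ is the graph obtained by deleting $v,w$ and all incident edges. A spanning 2-forest of a graph is a spanning forest with exactly two trees. If $P=P_1\cup P_2$ is a bipartition of a set of vertices, a spanning 2-forest is compatible with $P$ if one of its trees contains all vertices of $P_1$ and none of $P_2$, and the other contains all vertices of $P_2$ and none of $P_1$. For a bipartition $P$ of $\{a,b,c,d,e,f\}$, $\mathcal{R}_P$ is the set of bipartitions $(\psi,\phi)$ of the edge set of $R$ such that $\psi$ is a spanning tree of $R$ and $\phi$ is a spanning 2-forest of $R$ compatible with $P$; $r_P=|\mathcal{R}_P|$. *)

theory Defs
  imports "HOL-Number_Theory.Cong"
begin

text \<open>
  Graphs are finite undirected multigraphs. The set \<open>ends G e\<close> has two elements for an ordinary
  edge and one element for a loop; parallel edges are distinct edges with the same ends.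
\<close>

record ('v, 'e) mgraph =
  verts :: "'v set"
  edges :: "'e set"
  ends :: "'e \<Rightarrow> 'v set"

definition is_mgraph :: "('v, 'e) mgraph \<Rightarrow> bool" where
  "is_mgraph G \<longleftrightarrow> finite (verts G) \<and> finite (edges G) \<and>
     (\<forall>e\<in>edges G. ends G e \<subseteq> verts G \<and> (card (ends G e) = 1 \<or> card (ends G e) = 2))"

definition adjacent :: "('v, 'e) mgraph \<Rightarrow> 'v \<Rightarrow> 'v \<Rightarrow> bool" where
  "adjacent G x y \<longleftrightarrow> (\<exists>e\<in>edges G. ends G e = {x, y})"

definition neighbours :: "('v, 'e) mgraph \<Rightarrow> 'v \<Rightarrow> 'v set" where
  "neighbours G x = {y. adjacent G x y}"

text \<open>A loop contributes 2 to the degree of its vertex.\<close>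

definition vdegree :: "('v, 'e) mgraph \<Rightarrow> 'v \<Rightarrow> nat" where
  "vdegree G x = card {e \<in> edges G. x \<in> ends G e} + card {e \<in> edges G. ends G e = {x}}"

definition regular_mgraph :: "nat \<Rightarrow> ('v, 'e) mgraph \<Rightarrow> bool" where
  "regular_mgraph k G \<longleftrightarrow> (\<forall>x\<in>verts G. vdegree G x = k)"

definition delete_verts :: "('v, 'e) mgraph \<Rightarrow> 'v set \<Rightarrow> ('v, 'e) mgraph" where
  "delete_verts G X = G\<lparr>verts := verts G - X, edges := {e \<in> edges G. ends G e \<inter> X = {}}\<rparr>"

definition connected_mgraph :: "('v, 'e) mgraph \<Rightarrow> bool" where
  "connected_mgraph G \<longleftrightarrow> verts G \<noteq> {} \<and> (\<forall>x\<in>verts G. \<forall>y\<in>verts G. (adjacent G)\<^sup>*\<^sup>* x y)"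

text \<open>Connected components, given by their vertex sets.\<close>

definition components :: "('v, 'e) mgraph \<Rightarrow> 'v set set" where
  "components G = (\<lambda>x. {y \<in> verts G. (adjacent G)\<^sup>*\<^sup>* x y}) ` verts G"

text \<open>
  A cycle visits the distinct vertices \<open>xs\<close> in cyclic order along the distinct edges \<open>es\<close>. Loops are
  cycles of length 1 and pairs of parallel edges are cycles of length 2.
\<close>

definition is_cycle :: "('v, 'e) mgraph \<Rightarrow> 'v list \<Rightarrow> 'e list \<Rightarrow> bool" where
  "is_cycle G xs es \<longleftrightarrow> xs \<noteq> [] \<and> length es = length xs \<and> distinct xs \<and> distinct es \<and>
     set xs \<subseteq> verts G \<and> set es \<subseteq> edges G \<and>
     (\<forall>i<length xs. ends G (es ! i) = {xs ! i, xs ! (Suc i mod length xs)})"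

definition is_forest :: "('v, 'e) mgraph \<Rightarrow> bool" where
  "is_forest G \<longleftrightarrow> (\<nexists>xs es. is_cycle G xs es)"

definition is_tree :: "('v, 'e) mgraph \<Rightarrow> bool" where
  "is_tree G \<longleftrightarrow> connected_mgraph G \<and> is_forest G"

text \<open>Spanning subgraphs are given by their edge sets and may have isolated vertices.\<close>

definition spanning_subgraph :: "('v, 'e) mgraph \<Rightarrow> 'e set \<Rightarrow> ('v, 'e) mgraph" where
  "spanning_subgraph G F = G\<lparr>edges := F\<rparr>"

definition spanning_tree :: "('v, 'e) mgraph \<Rightarrow> 'e set \<Rightarrow> bool" where
  "spanning_tree G F \<longleftrightarrow> F \<subseteq> edges G \<and> is_tree (spanning_subgraph G F)"

definition spanning_2forest :: "('v, 'e) mgraph \<Rightarrow> 'e set \<Rightarrow> bool" where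
  "spanning_2forest G F \<longleftrightarrow> F \<subseteq> edges G \<and> is_forest (spanning_subgraph G F) \<and>
     card (components (spanning_subgraph G F)) = 2"

definition compatible :: "('v, 'e) mgraph \<Rightarrow> 'e set \<Rightarrow> 'v set \<Rightarrow> 'v set \<Rightarrow> bool" where
  "compatible G F P1 P2 \<longleftrightarrow> (\<exists>T1 T2. T1 \<noteq> T2 \<and> components (spanning_subgraph G F) = {T1, T2} \<and>
     P1 \<subseteq> T1 \<and> P2 \<inter> T1 = {} \<and> P2 \<subseteq> T2 \<and> P1 \<inter> T2 = {})"

definition edge_bipartitions :: "('v, 'e) mgraph \<Rightarrow> 'v set \<Rightarrow> 'v set \<Rightarrow> ('e set \<times> 'e set) set" where
  "edge_bipartitions R P1 P2 = {(\<psi>, \<phi>). \<psi> \<union> \<phi> = edges R \<and> \<psi> \<inter> \<phi> = {} \<and>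
     spanning_tree R \<psi> \<and> spanning_2forest R \<phi> \<and> compatible R \<phi> P1 P2}"

definition num_edge_bipartitions :: "('v, 'e) mgraph \<Rightarrow> 'v set \<Rightarrow> 'v set \<Rightarrow> nat" where
  "num_edge_bipartitions R P1 P2 = card (edge_bipartitions R P1 P2)"

definition fixed_point_free_involution_on :: "'a set \<Rightarrow> ('a \<Rightarrow> 'a) \<Rightarrow> bool" where
  "fixed_point_free_involution_on X \<iota> \<longleftrightarrow> (\<forall>p\<in>X. \<iota> p \<in> X \<and> \<iota> (\<iota> p) = p \<and> \<iota> p \<noteq> p)"

end

theory Submission
  imports Defs "HOL-Library.Z2"
begin

text \<open>
  All counting is modulo 2. Let \<open>R\<close> have vertex set \<open>V\<close> and edge set \<open>E\<close>, put \<open>S = {a, b, c, d, e, f}\<close> and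
  root \<open>R\<close> at \<open>r = f\<close>. A configuration is a spanning 2-forest \<open>\<phi>\<close> with \<open>E - \<phi>\<close> a spanning tree; \<open>W\<close> is
  the vertex set of the tree of \<open>\<phi>\<close> avoiding \<open>r\<close>, \<open>C\<close> the set of edges leaving \<open>W\<close>, \<open>k = |W \<inter> S|\<close>, and
  \<open>p\<close> the number of edges of \<open>E - \<phi>\<close> inside \<open>W\<close>. Counting degrees gives \<open>|C| + k + 2p = 2|W| + 2\<close>, so
  \<open>k \<in> {1, 5}\<close> holds iff \<open>k (1 + binom(|C|, 2) + |W| + p)\<close> is odd. Each of the four terms has even sum
  over all configurations:

  \<^item> \<open>\<Sum>[u \<in> W]\<close> vanishes for every vertex \<open>u\<close>: for \<open>e \<in> C\<close> the map \<open>\<phi> \<mapsto> E - \<phi> - e\<close> is an involution,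
    so the sum takes equal values at the two ends of every edge, and it is 0 at \<open>r\<close>.
  \<^item> Expanding \<open>[u \<in> W]\<close> along the path from \<open>r\<close> to \<open>u\<close> in \<open>E - \<phi>\<close> and applying the same involution gives
    \<open>\<Sum>|C| [u \<in> W] = \<Sum>[u \<in> W] = 0\<close>; since \<open>k\<close> and \<open>|C|\<close> have equal parity, this settles \<open>k |W|\<close>.
  \<^item> For \<open>binom(|C|, 2)\<close> group the pairs \<open>{h, h'} \<subseteq> C\<close> by the unicyclic graph \<open>U = \<phi> + h + h'\<close>: on the
    cycle of \<open>U\<close>, \<open>[u \<in> W] = q h + q h'\<close>, and for fixed \<open>h\<close> the admissible \<open>h'\<close> are the edges in which the
    cycle meets a cut.
  \<^item> For \<open>p\<close> group the pairs \<open>(\<phi>, g)\<close> by \<open>U = \<phi> + g\<close>; again the admissible \<open>g\<close> are the edges in which a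
    cycle meets a cut.
\<close>

section \<open>Arithmetic in the two-element field\<close>

declare add_bit_eq_xor [simp del] mult_bit_eq_and [simp del]

lemma bit_add_self [simp]: "x + x = (0::bit)" "x + (x + y) = (y::bit)"
  by (cases x; cases y; simp)+

lemma bit_add_eq_0_iff: "x + y = (0::bit) \<longleftrightarrow> x = y"
  by (cases x; cases y; simp)

lemma of_nat_bit_eq_of_bool: "(of_nat n :: bit) = of_bool (odd n)"
  by (induction n) auto

subsection \<open>Potentials, trees and cuts over the two-element field\<close>

locale rooted_graph =
  fixes V :: "'v set" and E :: "'e set" and en :: "'e \<Rightarrow> 'v set" and r :: 'v
  assumes finite_V: "finite V" and finite_E: "finite E"
    and en_subset: "e \<in> E \<Longrightarrow> en e \<subseteq> V"
    and card_en: "e \<in> E \<Longrightarrow> card (en e) = 2"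
    and root_in_V: "r \<in> V"
begin

text \<open>
  Forests, trees and cuts are expressed through potentials \<open>X :: 'v \<Rightarrow> bit\<close> and their coboundaries:
  \<open>F\<close> is a forest iff every edge of \<open>F\<close> has a dual potential (\<open>indep\<close>), and the potentials constant along
  \<open>F\<close> describe its components. \<open>Cut2 F W\<close> says that \<open>F\<close> is a spanning 2-forest and \<open>W\<close> the vertex set of
  its tree avoiding \<open>r\<close>, in which case \<open>W = side F\<close>.
\<close>

definition cobd :: "('v \<Rightarrow> bit) \<Rightarrow> 'e \<Rightarrow> bit" where
  "cobd X e = (\<Sum>x\<in>en e. X x)"

definition constant_along :: "'e set \<Rightarrow> ('v \<Rightarrow> bit) \<Rightarrow> bool" where
  "constant_along F X \<longleftrightarrow> (\<forall>e\<in>F. cobd X e = 0)"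

definition dual_on :: "'e set \<Rightarrow> 'e \<Rightarrow> ('v \<Rightarrow> bit) \<Rightarrow> bool" where
  "dual_on F e X \<longleftrightarrow> (\<forall>e'\<in>F. cobd X e' = of_bool (e' = e))"

definition indep :: "'e set \<Rightarrow> bool" where
  "indep F \<longleftrightarrow> F \<subseteq> E \<and> (\<forall>e\<in>F. \<exists>X. dual_on F e X)"

text \<open>The complement of the component of \<open>r\<close>, phrased as what some potential
  separates from \<open>r\<close>. It depends on \<open>F\<close> alone, so configurations need not
  carry their vertex set \<open>W\<close>.\<close>

definition side :: "'e set \<Rightarrow> 'v set" where
  "side F = {x\<in>V. \<exists>X. constant_along F X \<and> X x \<noteq> X r}"

definition ind :: "'v set \<Rightarrow> 'v \<Rightarrow> bit" where
  "ind W x = of_bool (x \<in> W)"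

definition Tree :: "'e set \<Rightarrow> bool" where
  "Tree F \<longleftrightarrow> indep F \<and> (\<forall>X. constant_along F X \<longrightarrow> (\<forall>x\<in>V. X x = X r))"

text \<open>The last clause makes the constants and \<open>ind W\<close> span the potentials
  constant along \<open>F\<close>, so there are exactly two components.\<close>

definition Cut2 :: "'e set \<Rightarrow> 'v set \<Rightarrow> bool" where
  "Cut2 F W \<longleftrightarrow> indep F \<and> W \<subseteq> V \<and> W \<noteq> {} \<and> r \<notin> W \<and> constant_along F (ind W) \<and>
     (\<forall>X. constant_along F X \<longrightarrow> (\<exists>c. \<forall>x\<in>V. X x = X r + c * ind W x))"

lemma cobd_add [simp]: "cobd (\<lambda>x. X x + Y x) e = cobd X e + cobd Y e"
  by (simp add: cobd_def sum.distrib)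

lemma cobd_scale [simp]: "cobd (\<lambda>x. c * X x) e = c * cobd X e"
  by (simp add: cobd_def sum_distrib_left)

lemma cobd_sum [simp]: "cobd (\<lambda>x. \<Sum>i\<in>I. X i x) e = (\<Sum>i\<in>I. cobd (X i) e)"
  unfolding cobd_def by (rule sum.swap)

lemma cobd_const [simp]: "e \<in> E \<Longrightarrow> cobd (\<lambda>_. c) e = 0"
  by (simp add: cobd_def card_en)

lemma cobd_cong: "e \<in> E \<Longrightarrow> (\<And>x. x \<in> V \<Longrightarrow> X x = Y x) \<Longrightarrow> cobd X e = cobd Y e"
  unfolding cobd_def by (rule sum.cong) (use en_subset in auto)

lemma cobd_of_constant: "e \<in> E \<Longrightarrow> (\<And>x. x \<in> V \<Longrightarrow> X x = c) \<Longrightarrow> cobd X e = 0"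
  using cobd_cong[of e X "\<lambda>_. c"] by simp

lemma indep_subset_E: "indep F \<Longrightarrow> F \<subseteq> E"
  by (simp add: indep_def)

lemma indep_finite: "indep F \<Longrightarrow> finite F"
  using finite_E finite_subset by (auto simp: indep_def)

lemma indep_subset: "indep F \<Longrightarrow> F' \<subseteq> F \<Longrightarrow> indep F'"
  unfolding indep_def dual_on_def by (meson subset_iff)

lemma Tree_indep: "Tree F \<Longrightarrow> indep F" and Cut2_indep: "Cut2 F W \<Longrightarrow> indep F"
  by (auto simp: Tree_def Cut2_def)

lemma Cut2_side:
  assumes "Cut2 F W"
  shows "side F = W"
proof (intro equalityI subsetI)
  fix x assume "x \<in> side F"
  then obtain X where X: "x \<in> V" "constant_along F X" "X x \<noteq> X r"
    by (auto simp: side_def)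
  then obtain c where "\<forall>x\<in>V. X x = X r + c * ind W x"
    using assms unfolding Cut2_def by blast
  then show "x \<in> W" using X by (auto simp: ind_def split: if_splits)
next
  fix x assume "x \<in> W"
  then show "x \<in> side F" using assms
    by (auto simp: Cut2_def side_def ind_def intro!: exI[of _ "ind W"])
qed

text \<open>Since \<open>Y\<close> vanishes on \<open>F\<close> and is 1 at \<open>g\<close>, adding
  a multiple of it corrects the value at \<open>g\<close> without disturbing the duality on
  \<open>F\<close>.\<close>

lemma dual_modify:
  assumes "dual_on F e X" "constant_along F Y" "cobd Y g = 1" "e \<noteq> g"
  shows "dual_on (insert g F) e (\<lambda>x. X x + cobd X g * Y x)"
  using assms by (auto simp: dual_on_def constant_along_def)

lemma indep_insert:
  assumes "indep F" "g \<in> E" "g \<notin> F" "constant_along F Y" "cobd Y g = 1"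
  shows "indep (insert g F)"
proof -
  have "dual_on (insert g F) g Y"
    using assms by (auto simp: dual_on_def constant_along_def)
  moreover have "\<exists>X. dual_on (insert g F) e X" if "e \<in> F" for e
    using dual_modify[OF _ assms(4,5)] that assms unfolding indep_def by metis
  ultimately show ?thesis
    using assms by (auto simp: indep_def)
qed

text \<open>The edge \<open>e\<close> joins the two components: a potential
  \<open>X r + c * ind W\<close> has coboundary \<open>c\<close> at \<open>e\<close>, so being
  constant along \<open>e\<close> as well forces \<open>c = 0\<close>.\<close>

lemma Cut2_insert:
  assumes "Cut2 F W" "e \<in> E" "cobd (ind W) e = 1"
  shows "e \<notin> F" "Tree (insert e F)"
proof -
  show e: "e \<notin> F" using assms by (auto simp: Cut2_def constant_along_def)
  have "indep (insert e F)"
    by (rule indep_insert[of _ _ "ind W"]) (use assms e in \<open>auto simp: Cut2_def\<close>)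
  moreover have "X x = X r" if X: "constant_along (insert e F) X" "x \<in> V" for X x
  proof -
    have "constant_along F X" using X by (auto simp: constant_along_def)
    then obtain c where c: "\<forall>x\<in>V. X x = X r + c * ind W x"
      using assms(1) unfolding Cut2_def by blast
    have "cobd X e = cobd (\<lambda>x. X r + c * ind W x) e"
      by (rule cobd_cong) (use assms c in auto)
    also have "\<dots> = c" using assms by simp
    finally have "c = 0" using X by (auto simp: constant_along_def)
    then show ?thesis using c X by simp
  qed
  ultimately show "Tree (insert e F)" by (simp add: Tree_def)
qed

lemma Cut2_insert_Tree_crosses:
  assumes "Cut2 F W" "Tree (insert e F)"
  shows "cobd (ind W) e = 1"
proof (rule ccontr)
  assume "cobd (ind W) e \<noteq> 1"
  then have "constant_along (insert e F) (ind W)"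
    using assms by (auto simp: Cut2_def constant_along_def)
  then have "\<forall>x\<in>V. ind W x = ind W r"
    using assms by (auto simp: Tree_def)
  then show False using assms(1) by (auto simp: Cut2_def ind_def)
qed

text \<open>The dual potential of \<open>e\<close> in \<open>T\<close> jumps only across
  \<open>e\<close>, so the set where it differs from its value at \<open>r\<close> is the side of
  the fundamental cut of \<open>e\<close>.\<close>

lemma Tree_remove:
  assumes "Tree T" "e \<in> T"
  shows "Cut2 (T - {e}) (side (T - {e}))" "cobd (ind (side (T - {e}))) e = 1"
proof -
  obtain X where X: "dual_on T e X"
    using assms by (auto simp: Tree_def indep_def)
  have TE: "T \<subseteq> E" using assms by (auto simp: Tree_def indep_def)
  define W where "W = {x\<in>V. X x \<noteq> X r}"
  have XW: "X x = X r + ind W x" if "x \<in> V" for x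
    using that by (cases "X x"; cases "X r") (auto simp: W_def ind_def)
  have dW: "cobd (ind W) e' = cobd X e'" if "e' \<in> E" for e'
    using cobd_cong[of e' X "\<lambda>x. X r + ind W x"] XW that by simp
  have ker: "\<exists>c. \<forall>x\<in>V. Y x = Y r + c * ind W x" if Y: "constant_along (T - {e}) Y" for Y
  proof -
    \<comment> \<open>Adding this multiple of \<open>ind W\<close> cancels the coboundary at
      \<open>e\<close>, so \<open>?Z\<close> is constant along all of \<open>T\<close>, hence
      constant.\<close>
    let ?Z = "\<lambda>x. Y x + cobd Y e * ind W x"
    have "constant_along T ?Z"
      using Y X dW TE assms(2) by (auto simp: constant_along_def dual_on_def)
    then have "?Z x = ?Z r" if "x \<in> V" for x
      using assms that by (auto simp: Tree_def)
    moreover have "ind W r = 0" by (simp add: ind_def W_def)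
    ultimately have "Y x = Y r + cobd Y e * ind W x" if "x \<in> V" for x
      using that by (metis add.right_neutral bit_add_self(1) group_cancel.add1 mult_zero_right)
    then show ?thesis by blast
  qed
  have "W \<noteq> {}"
  proof
    assume "W = {}"
    then have "cobd (ind W) e = 0" by (auto simp: cobd_def ind_def)
    then show False using dW X assms TE by (auto simp: dual_on_def)
  qed
  moreover have "constant_along (T - {e}) (ind W)"
    using dW X TE by (auto simp: constant_along_def dual_on_def)
  moreover have "indep (T - {e})" using assms indep_subset by (auto simp: Tree_def)
  ultimately have *: "Cut2 (T - {e}) W"
    using ker by (auto simp: Cut2_def W_def)
  then have "side (T - {e}) = W" by (rule Cut2_side)
  then show "Cut2 (T - {e}) (side (T - {e}))" "cobd (ind (side (T - {e}))) e = 1"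
    using * dW X assms TE by (auto simp: dual_on_def)
qed

text \<open>The factor \<open>ind (side (T - {e})) u\<close> says that \<open>e\<close> lies on the
  path of \<open>T\<close> from \<open>r\<close> to \<open>u\<close>; the formula telescopes along
  this path. It holds because the fundamental cuts are dual to the edges of \<open>T\<close> and
  both sides agree at \<open>r\<close>.\<close>

lemma Tree_expansion:
  assumes "Tree T" "u \<in> V"
  shows "X u = X r + (\<Sum>e\<in>T. cobd X e * ind (side (T - {e})) u)"
proof -
  let ?Y = "\<lambda>x. \<Sum>e\<in>T. cobd X e * ind (side (T - {e})) x"
  let ?Z = "\<lambda>x. X x + ?Y x"
  have fin: "finite T" and TE: "T \<subseteq> E" using assms indep_finite by (auto simp: Tree_def indep_def)
  have *: "cobd (ind (side (T - {e}))) e' = of_bool (e = e')" if "e \<in> T" "e' \<in> T" for e e'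
    using Tree_remove[OF assms(1) that(1)] that by (auto simp: Cut2_def constant_along_def)
  have "cobd ?Y e' = cobd X e'" if "e' \<in> T" for e'
  proof -
    have "cobd ?Y e' = (\<Sum>e\<in>T. if e = e' then cobd X e' else 0)"
      unfolding cobd_sum cobd_scale by (rule sum.cong) (use * that in auto)
    then show ?thesis using fin that by simp
  qed
  then have "constant_along T ?Z" by (auto simp: constant_along_def)
  then have "?Z u = ?Z r" using assms by (auto simp: Tree_def)
  moreover have "?Y r = 0"
    by (rule sum.neutral) (auto simp: ind_def side_def)
  ultimately show ?thesis
    by (metis (no_types, lifting) add.assoc add.right_neutral bit_add_self(1))
qed

text \<open>The edge set of the unique cycle, if \<open>U\<close> is a forest plus one edge closing a cycle.\<close>

definition circuit :: "'e set \<Rightarrow> 'e set" where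
  "circuit U = {h\<in>U. indep (U - {h})}"

text \<open>A cut meets a cycle in an even number of edges. The duals \<open>D h\<close> of the
  forest \<open>U - {g}\<close> express the coboundary at \<open>g\<close> through the forest edges,
  and the edges that occur in this relation are exactly the circuit edges other than
  \<open>g\<close>.\<close>

lemma cobd_sum_circuit:
  assumes "g \<in> U" "indep (U - {g})" "\<not> indep U" "g \<in> E"
  shows "(\<Sum>h\<in>circuit U. cobd X h) = 0"
proof -
  define F where "F = U - {g}"
  have F: "indep F" "U = insert g F" "g \<notin> F" using assms by (auto simp: F_def)
  have FE: "F \<subseteq> E" and finF: "finite F" using F indep_finite by (auto simp: indep_def)
  obtain D where D: "\<And>h. h \<in> F \<Longrightarrow> dual_on F h (D h)"
    using F(1) unfolding indep_def by metis
  have kerF: "cobd Y g = 0" if "constant_along F Y" for Y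
    using indep_insert[OF F(1) assms(4) F(3) that] assms(3) F(2) by (cases "cobd Y g") auto
  have rel: "cobd X g = (\<Sum>h\<in>F. cobd X h * cobd (D h) g)" for X
  proof -
    \<comment> \<open>Subtracting the expansion of \<open>X\<close> in the dual potentials leaves a
      potential constant along \<open>F\<close>, which cannot cross \<open>g\<close> because
      \<open>U\<close> is dependent.\<close>
    let ?Y = "\<lambda>x. X x + (\<Sum>h\<in>F. cobd X h * D h x)"
    have "constant_along F ?Y"
      unfolding constant_along_def
    proof
      fix e assume e: "e \<in> F"
      have "(\<Sum>h\<in>F. cobd X h * cobd (D h) e) = (\<Sum>h\<in>F. if h = e then cobd X e else 0)"
        by (rule sum.cong) (use D e in \<open>auto simp: dual_on_def\<close>)
      then show "cobd ?Y e = 0" using e finF by simp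
    qed
    from kerF[OF this] show ?thesis by (simp add: bit_add_eq_0_iff)
  qed
  \<comment> \<open>Exchange property: \<open>h\<close> can be traded for \<open>g\<close> exactly
    when \<open>h\<close> occurs in the relation for \<open>g\<close>.\<close>
  have ind_iff: "indep (U - {h}) \<longleftrightarrow> cobd (D h) g = 1" if h: "h \<in> F" for h
  proof
    assume "indep (U - {h})"
    moreover have gU: "g \<in> U - {h}" using F h by auto
    ultimately obtain Y where Y: "dual_on (U - {h}) g Y"
      unfolding indep_def by blast
    have "cobd Y g = (\<Sum>k\<in>F. if k = h then cobd Y h * cobd (D h) g else 0)"
      unfolding rel[of Y] by (rule sum.cong) (use Y F in \<open>auto simp: dual_on_def\<close>)
    then have "cobd Y g = cobd Y h * cobd (D h) g" using finF h by simp
    moreover have "cobd Y g = 1" using Y gU unfolding dual_on_def by simp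
    ultimately show "cobd (D h) g = 1" by (cases "cobd (D h) g") auto
  next
    assume *: "cobd (D h) g = 1"
    have "U - {h} = insert g (F - {h})" using F h by auto
    moreover have "indep (insert g (F - {h}))"
      by (rule indep_insert[of _ _ "D h"])
        (use F * D[OF h] assms(4) in \<open>auto intro: indep_subset simp: constant_along_def dual_on_def\<close>)
    ultimately show "indep (U - {h})" by simp
  qed
  have "circuit U = insert g {h\<in>F. cobd (D h) g = 1}"
    using F(2,3) ind_iff assms(2) unfolding circuit_def by auto
  then have "(\<Sum>h\<in>circuit U. cobd X h) = cobd X g + (\<Sum>h\<in>{h\<in>F. cobd (D h) g = 1}. cobd X h)"
    using F(3) finF by simp
  also have "(\<Sum>h\<in>{h\<in>F. cobd (D h) g = 1}. cobd X h) = (\<Sum>h\<in>F. cobd X h * cobd (D h) g)"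
    by (subst sum.inter_filter) (use finF in \<open>auto intro!: sum.cong\<close>)
  also have "\<dots> = cobd X g" by (rule rel[symmetric])
  finally show ?thesis by simp
qed

end

lemma of_nat_card_bit: "finite A \<Longrightarrow> of_nat (card {x\<in>A. f x = (1::bit)}) = (\<Sum>x\<in>A. f x)"
proof -
  assume "finite A"
  then have "(\<Sum>x\<in>A. f x) = (\<Sum>x\<in>A. if f x = 1 then 1 else 0)"
    by (intro sum.cong) auto
  then show ?thesis using \<open>finite A\<close> by (simp flip: sum.inter_filter)
qed

section \<open>Exchanging edges along a circuit\<close>

context rooted_graph
begin

lemma cobd_ind_eq_0_iff:
  assumes "e \<in> E"
  shows "cobd (ind W) e = 0 \<longleftrightarrow> en e \<subseteq> W \<or> en e \<inter> W = {}"
proof -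
  obtain x y where "en e = {x, y}" "x \<noteq> y"
    using card_en[OF assms] by (auto simp: card_2_iff)
  then show ?thesis by (cases "x \<in> W"; cases "y \<in> W") (auto simp: cobd_def ind_def)
qed

text \<open>The coboundary sums to 0 over the circuit, so it cannot be nonzero at the single edge
  \<open>h\<close>.\<close>

lemma constant_along_circuit:
  assumes "g \<in> U" "indep (U - {g})" "\<not> indep U" "U \<subseteq> E" "h \<in> circuit U"
    and Y: "constant_along (U - {h}) Y"
  shows "constant_along U Y"
proof -
  have "(\<Sum>k\<in>circuit U. cobd Y k) = 0"
    using cobd_sum_circuit assms by blast
  moreover have "(\<Sum>k\<in>circuit U. cobd Y k) = (\<Sum>k\<in>{h}. cobd Y k)"
    by (rule sum.mono_neutral_right)
      (use assms finite_subset[OF _ finite_E] in \<open>auto simp: circuit_def constant_along_def\<close>)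
  ultimately show ?thesis using Y by (auto simp: constant_along_def)
qed

lemma Tree_insert_dependent:
  assumes "g \<in> U" "Tree (U - {g})" "U \<subseteq> E"
  shows "\<not> indep U"
proof
  assume "indep U"
  then obtain Y where Y: "dual_on U g Y" using assms unfolding indep_def by blast
  then have "constant_along (U - {g}) Y" by (auto simp: constant_along_def dual_on_def)
  then have "\<And>x. x \<in> V \<Longrightarrow> Y x = Y r" using assms by (auto simp: Tree_def)
  then have "cobd Y g = 0" using cobd_of_constant assms by blast
  then show False using Y assms by (auto simp: dual_on_def)
qed

lemma circuit_eq_Tree:
  assumes "g \<in> U" "Tree (U - {g})" "U \<subseteq> E"
  shows "circuit U = {h\<in>U. Tree (U - {h})}"
proof -
  have "Tree (U - {h})" if h: "h \<in> circuit U" for h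
  proof -
    have "X x = X r" if "constant_along (U - {h}) X" "x \<in> V" for X x
    proof -
      have "constant_along U X"
        using constant_along_circuit[OF assms(1) Tree_indep[OF assms(2)]
            Tree_insert_dependent[OF assms] assms(3) h that(1)] .
      then have "constant_along (U - {g}) X" by (auto simp: constant_along_def)
      then show ?thesis using assms that by (auto simp: Tree_def)
    qed
    then show ?thesis using h by (auto simp: Tree_def circuit_def)
  qed
  then show ?thesis by (auto simp: circuit_def Tree_def)
qed

text \<open>An edge not crossing \<open>W\<close> separates no further potentials, so it closes a
  cycle, and removing any edge of that cycle leaves the same two components.\<close>

lemma Cut2_insert_inside:
  assumes "g \<in> U" "Cut2 (U - {g}) W" "U \<subseteq> E" "cobd (ind W) g = 0"
  shows "\<not> indep U" "h \<in> circuit U \<Longrightarrow> Cut2 (U - {h}) W"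
proof -
  have ker: "constant_along U Y" if Y: "constant_along (U - {g}) Y" for Y
  proof -
    obtain c where c: "\<forall>x\<in>V. Y x = Y r + c * ind W x"
      using Y assms(2) unfolding Cut2_def by blast
    have "cobd Y g = cobd (\<lambda>x. Y r + c * ind W x) g"
      by (rule cobd_cong) (use assms c in auto)
    also have "\<dots> = 0" using assms by auto
    finally show ?thesis using Y by (auto simp: constant_along_def)
  qed
  show dep: "\<not> indep U"
  proof
    assume "indep U"
    then obtain Y where Y: "dual_on U g Y" using assms unfolding indep_def by blast
    then have "constant_along U Y" by (intro ker) (auto simp: constant_along_def dual_on_def)
    then show False using Y assms by (auto simp: dual_on_def constant_along_def)
  qed
  assume h: "h \<in> circuit U"
  have "constant_along (U - {g}) X" if "constant_along (U - {h}) X" for X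
    using constant_along_circuit[OF assms(1) Cut2_indep[OF assms(2)] dep assms(3) h that]
    by (auto simp: constant_along_def)
  moreover have "constant_along (U - {h}) (ind W)"
    using ker[of "ind W"] assms(2) by (auto simp: Cut2_def constant_along_def)
  ultimately show "Cut2 (U - {h}) W"
    using assms(2) h unfolding Cut2_def circuit_def by blast
qed

subsection \<open>Sums over configurations\<close>

definition Conf :: "'e set set" where
  "Conf = {\<phi>. \<phi> \<subseteq> E \<and> Cut2 \<phi> (side \<phi>) \<and> Tree (E - \<phi>)}"

definition crossing :: "'e set \<Rightarrow> 'e set" where
  "crossing \<phi> = {e\<in>E. cobd (ind (side \<phi>)) e = 1}"

lemma Conf_subset: "\<phi> \<in> Conf \<Longrightarrow> \<phi> \<subseteq> E"
  by (simp add: Conf_def)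

lemma finite_Conf: "finite Conf"
  by (rule finite_subset[of _ "Pow E"]) (auto simp: Conf_def finite_E)

lemma finite_crossing: "finite (crossing \<phi>)"
  using finite_E by (auto simp: crossing_def)

text \<open>Moving a crossing edge \<open>e\<close> turns the 2-forest into a tree and the tree into
  a 2-forest. So \<open>\<phi> \<mapsto> E - \<phi> - {e}\<close> is an involution on the
  configurations crossed by \<open>e\<close>.\<close>

lemma swap_Conf:
  assumes "\<phi> \<in> Conf" "e \<in> crossing \<phi>"
  shows "E - \<phi> - {e} \<in> Conf" "e \<in> crossing (E - \<phi> - {e})" "E - (E - \<phi> - {e}) - {e} = \<phi>"
    "e \<notin> \<phi>"
proof -
  have e: "e \<in> E" "Cut2 \<phi> (side \<phi>)" "Tree (E - \<phi>)" "\<phi> \<subseteq> E" "cobd (ind (side \<phi>)) e = 1"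
    using assms by (auto simp: Conf_def crossing_def)
  note I = Cut2_insert[OF e(2,1,5)]
  show "e \<notin> \<phi>" by (rule I)
  have R: "Cut2 (E - \<phi> - {e}) (side (E - \<phi> - {e}))" "cobd (ind (side (E - \<phi> - {e}))) e = 1"
    using Tree_remove[OF e(3), of e] e I by auto
  have "E - (E - \<phi> - {e}) = insert e \<phi>" using e by auto
  then show "E - \<phi> - {e} \<in> Conf" "e \<in> crossing (E - \<phi> - {e})" "E - (E - \<phi> - {e}) - {e} = \<phi>"
    using R I e by (auto simp: Conf_def crossing_def)
qed

text \<open>As a function of \<open>u\<close> the sum is a potential whose coboundary at
  \<open>e\<close> counts, modulo 2, the configurations crossed by \<open>e\<close>. These are even
  in number, so the potential is constant along a spanning tree and equals its value 0 at
  \<open>r\<close>.\<close>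

lemma sum_Conf_side:
  assumes "\<And>e. E \<noteq> {e}" "u \<in> V"
  shows "(\<Sum>\<phi>\<in>Conf. ind (side \<phi>) u) = 0"
proof (cases "Conf = {}")
  case False
  then obtain \<phi>\<^sub>0 where \<phi>\<^sub>0: "Tree (E - \<phi>\<^sub>0)" by (auto simp: Conf_def)
  let ?f = "\<lambda>x. \<Sum>\<phi>\<in>Conf. ind (side \<phi>) x"
  have "cobd ?f e = 0" if e: "e \<in> E" for e
  proof -
    \<comment> \<open>A second edge \<open>e\<^sub>0\<close> splits these configurations into two
      classes that the involution exchanges, so it has no fixed point.\<close>
    obtain e\<^sub>0 where e0: "e\<^sub>0 \<in> E" "e\<^sub>0 \<noteq> e" using assms(1)[of e] e by blast
    let ?A = "{\<phi>\<in>Conf. e \<in> crossing \<phi>}"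
    let ?A1 = "{\<phi>\<in>?A. e\<^sub>0 \<in> \<phi>}" and ?A2 = "{\<phi>\<in>?A. e\<^sub>0 \<notin> \<phi>}"
    have "bij_betw (\<lambda>\<phi>. E - \<phi> - {e}) ?A1 ?A2"
      by (rule bij_betw_byWitness[where f' = "\<lambda>\<phi>. E - \<phi> - {e}"]) (use swap_Conf e0 Conf_subset in auto)
    then have "card ?A1 = card ?A2" by (rule bij_betw_same_card)
    moreover have "card (?A1 \<union> ?A2) = card ?A1 + card ?A2"
      by (rule card_Un_disjoint) (auto simp: finite_Conf)
    moreover have "?A1 \<union> ?A2 = ?A" by auto
    ultimately have "card ?A = 2 * card ?A1" by simp
    then have "(of_nat (card ?A) :: bit) = 0" by (simp add: of_nat_bit_eq_of_bool)
    then have "of_nat (card {\<phi>\<in>Conf. cobd (ind (side \<phi>)) e = 1}) = (0::bit)"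
      using e by (simp add: crossing_def)
    then show ?thesis by (simp add: of_nat_card_bit finite_Conf)
  qed
  then have "constant_along (E - \<phi>\<^sub>0) ?f" by (auto simp: constant_along_def)
  then have "?f u = ?f r" using \<phi>\<^sub>0 assms(2) unfolding Tree_def by blast
  also have "?f r = 0" by (rule sum.neutral) (auto simp: ind_def side_def)
  finally show ?thesis .
qed auto

lemma sum_Conf_crossing_side:
  assumes "u \<in> V"
  shows "(\<Sum>\<phi>\<in>Conf. of_nat (card (crossing \<phi>)) * ind (side \<phi>) u) = (\<Sum>\<phi>\<in>Conf. ind (side \<phi>) u)"
proof -
  \<comment> \<open>The path from \<open>r\<close> to \<open>u\<close> in the complementary tree
    crosses the cut an odd number of times iff \<open>u\<close> lies in
    \<open>side \<phi>\<close>.\<close>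
  have "ind (side \<phi>) u = (\<Sum>e\<in>crossing \<phi>. ind (side (E - \<phi> - {e})) u)" if \<phi>: "\<phi> \<in> Conf" for \<phi>
  proof -
    have T: "Tree (E - \<phi>)" using \<phi> by (auto simp: Conf_def)
    have "ind (side \<phi>) u = ind (side \<phi>) r +
        (\<Sum>e\<in>E - \<phi>. cobd (ind (side \<phi>)) e * ind (side (E - \<phi> - {e})) u)"
      by (rule Tree_expansion[OF T assms])
    also have "ind (side \<phi>) r = 0" by (simp add: ind_def side_def)
    also have "(\<Sum>e\<in>E - \<phi>. cobd (ind (side \<phi>)) e * ind (side (E - \<phi> - {e})) u) =
        (\<Sum>e\<in>crossing \<phi>. cobd (ind (side \<phi>)) e * ind (side (E - \<phi> - {e})) u)"
      by (rule sum.mono_neutral_right) (use finite_E swap_Conf(4)[OF \<phi>] in \<open>auto simp: crossing_def\<close>)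
    also have "\<dots> = (\<Sum>e\<in>crossing \<phi>. ind (side (E - \<phi> - {e})) u)"
      by (rule sum.cong) (auto simp: crossing_def)
    finally show ?thesis by simp
  qed
  then have "(\<Sum>\<phi>\<in>Conf. ind (side \<phi>) u) = (\<Sum>\<phi>\<in>Conf. \<Sum>e\<in>crossing \<phi>. ind (side (E - \<phi> - {e})) u)"
    by simp
  also have "\<dots> = (\<Sum>(\<phi>, e)\<in>Sigma Conf crossing. ind (side (E - \<phi> - {e})) u)"
    by (simp add: sum.Sigma finite_Conf finite_crossing)
  \<comment> \<open>The swap keeps \<open>e\<close> and trades the two partners, which removes the
    dependence of the summand on \<open>e\<close>.\<close>
  also have "\<dots> = (\<Sum>(\<phi>, e)\<in>Sigma Conf crossing. ind (side \<phi>) u)"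
    by (rule sum.reindex_bij_witness[where i = "\<lambda>(\<phi>, e). (E - \<phi> - {e}, e)" and j = "\<lambda>(\<phi>, e). (E - \<phi> - {e}, e)"])
      (use swap_Conf in \<open>auto intro: subsetD[OF Conf_subset]\<close>)
  also have "\<dots> = (\<Sum>\<phi>\<in>Conf. \<Sum>e\<in>crossing \<phi>. ind (side \<phi>) u)"
    by (rule sum.Sigma[symmetric]) (auto simp: finite_Conf finite_crossing)
  finally show ?thesis by simp
qed

lemma sum_Conf_inside:
  "(\<Sum>\<phi>\<in>{\<phi>\<in>Conf. side \<phi> = W}. of_nat (card {g\<in>E - \<phi>. en g \<subseteq> W})) = (0::bit)"
proof -
  let ?C = "{\<phi>\<in>Conf. side \<phi> = W}" and ?I = "\<lambda>\<phi>. {g\<in>E - \<phi>. en g \<subseteq> W}"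
  \<comment> \<open>The edges \<open>g\<close> that may be split off from the merged graph
    \<open>U = \<phi> + g\<close>; both \<open>g\<close> and \<open>\<phi>\<close> are recovered
    from \<open>U\<close> and \<open>g\<close>.\<close>
  let ?K = "\<lambda>U. {g\<in>U. Cut2 (U - {g}) W \<and> en g \<subseteq> W \<and> Tree (E - (U - {g}))}"
  have K: "of_nat (card (?K U)) = (0::bit)" if U: "U \<in> Pow E" for U
  proof (cases "?K U = {}")
    case False
    then obtain g where g: "g \<in> U" "Cut2 (U - {g}) W" "en g \<subseteq> W" "Tree (E - (U - {g}))"
      by blast
    have UE: "U \<subseteq> E" and gE: "g \<in> E" and finU: "finite U"
      using U g finite_subset[OF _ finite_E] by auto
    have dg: "cobd (ind W) g = 0" using cobd_ind_eq_0_iff gE g by auto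
    note dep = Cut2_insert_inside[OF g(1,2) UE dg]
    define W' where "W' = side (E - U)"
    have "E - (U - {g}) - {g} = E - U" using g by auto
    then have W': "Cut2 (E - U) W'"
      using Tree_remove(1)[OF g(4), of g] gE by (auto simp: W'_def)
    have eq: "E - (U - {h}) = insert h (E - U)" if "h \<in> U" for h using UE that by auto
    \<comment> \<open>Whether the complement is a tree depends only on \<open>h\<close> crossing the
      fixed 2-forest \<open>E - U\<close>.\<close>
    have cr: "Tree (E - (U - {h})) \<longleftrightarrow> cobd (ind W') h = 1" if "h \<in> U" for h
      unfolding eq[OF that] using Cut2_insert(2)[OF W'] Cut2_insert_Tree_crosses[OF W'] that UE by auto
    have W0: "cobd (ind W) h = 0" if "h \<in> U" for h
      using that dg g(2) by (cases "h = g") (auto simp: Cut2_def constant_along_def)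
    \<comment> \<open>Edges of \<open>U\<close> do not cross \<open>W\<close>, so intersecting
      \<open>W'\<close> with \<open>W\<close> discards exactly the crossings outside
      \<open>W\<close>, wherever the circuit lies.\<close>
    have int: "cobd (ind (W' \<inter> W)) h = (if en h \<subseteq> W then cobd (ind W') h else 0)" if "h \<in> U" for h
    proof -
      have "en h \<subseteq> W \<or> en h \<inter> W = {}" using cobd_ind_eq_0_iff[of h W] W0 that UE by auto
      then show ?thesis
        by (auto simp: cobd_def ind_def intro!: sum.cong sum.neutral)
    qed
    have "h \<in> circuit U \<longleftrightarrow> Cut2 (U - {h}) W" if "h \<in> U" for h
      using dep(2)[of h] Cut2_indep[of "U - {h}" W] that unfolding circuit_def by blast
    then have "?K U = {h\<in>circuit U. cobd (ind (W' \<inter> W)) h = 1}"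
      using cr int by (auto simp: circuit_def split: if_splits)
    then have "of_nat (card (?K U)) = (\<Sum>h\<in>circuit U. cobd (ind (W' \<inter> W)) h)"
      using of_nat_card_bit[of "circuit U" "cobd (ind (W' \<inter> W))"] finU by (simp add: circuit_def)
    also have "\<dots> = 0" using cobd_sum_circuit[OF g(1) Cut2_indep[OF g(2)] dep(1) gE] .
    finally show ?thesis .
  qed (simp only: card.empty of_nat_0)
  have "(\<Sum>\<phi>\<in>?C. of_nat (card (?I \<phi>))) = (\<Sum>\<phi>\<in>?C. \<Sum>g\<in>?I \<phi>. (1::bit))" by simp
  also have "\<dots> = (\<Sum>(\<phi>, g)\<in>Sigma ?C ?I. 1)"
    by (rule sum.Sigma) (auto simp: finite_Conf finite_E)
  also have "\<dots> = (\<Sum>(U, g)\<in>Sigma (Pow E) ?K. 1)"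
  proof (rule sum.reindex_bij_witness[where j = "\<lambda>(\<phi>, g). (insert g \<phi>, g)" and i = "\<lambda>(U, g). (U - {g}, g)"])
    fix p assume "p \<in> Sigma ?C ?I"
    then obtain \<phi> g where p: "p = (\<phi>, g)" "\<phi> \<in> Conf" "side \<phi> = W" "g \<in> E" "g \<notin> \<phi>" "en g \<subseteq> W"
      by auto
    then have "insert g \<phi> - {g} = \<phi>" by auto
    then show "(case case p of (\<phi>, g) \<Rightarrow> (insert g \<phi>, g) of (U, g) \<Rightarrow> (U - {g}, g)) = p"
      and "(case p of (\<phi>, g) \<Rightarrow> (insert g \<phi>, g)) \<in> Sigma (Pow E) ?K"
      using p by (auto simp: Conf_def)
  next
    fix p assume "p \<in> Sigma (Pow E) ?K"
    then obtain U g where p: "p = (U, g)" "U \<subseteq> E" "g \<in> U" "Cut2 (U - {g}) W" "en g \<subseteq> W"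
      "Tree (E - (U - {g}))" by auto
    then show "(case case p of (U, g) \<Rightarrow> (U - {g}, g) of (\<phi>, g) \<Rightarrow> (insert g \<phi>, g)) = p"
      and "(case p of (U, g) \<Rightarrow> (U - {g}, g)) \<in> Sigma ?C ?I"
      using Cut2_side[OF p(4)] by (auto simp: Conf_def)
  qed simp
  also have "\<dots> = (\<Sum>U\<in>Pow E. \<Sum>g\<in>?K U. 1)"
    by (rule sum.Sigma[symmetric]) (use finite_E in \<open>auto intro: rev_finite_subset\<close>)
  also have "\<dots> = (\<Sum>U\<in>Pow E. of_nat (card (?K U)))" by simp
  also have "\<dots> = 0" by (rule sum.neutral) (use K in blast)
  finally show ?thesis .
qed


lemma sum_Conf_pairs_side:
  assumes u: "u \<in> V"
  shows "(\<Sum>\<phi>\<in>Conf. of_nat (card (crossing \<phi>) choose 2) * ind (side \<phi>) u) = 0"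
proof -
  let ?I = "\<lambda>\<phi>. {P. P \<subseteq> crossing \<phi> \<and> card P = 2}"
  let ?K = "\<lambda>U. {P. P \<subseteq> U \<and> card P = 2 \<and> Cut2 (U - P) (side (U - P)) \<and> Tree (E - (U - P)) \<and>
      P \<subseteq> crossing (U - P)}"
  have K: "(\<Sum>P\<in>?K U. ind (side (U - P)) u) = 0" if U: "U \<in> Pow E" for U
  proof (cases "?K U = {}")
    case False
    then obtain P\<^sub>0 where P0: "P\<^sub>0 \<in> ?K U" by blast
    have UE: "U \<subseteq> E" and finU: "finite U" using U finite_subset[OF _ finite_E] by auto
    \<comment> \<open>Dropping one edge of an admissible pair leaves the 2-forest plus one crossing
      edge.\<close>
    have TreeU: "Tree (U - {k})" if PK: "P \<in> ?K U" and k: "k \<in> P" for P k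
    proof -
      have P: "P \<subseteq> U" "card P = 2" "Cut2 (U - P) (side (U - P))" "P \<subseteq> crossing (U - P)"
        using PK by auto
      obtain h where h: "P = {k, h}" "h \<noteq> k"
        using P(2) k by (auto simp: card_2_iff)
      have "Tree (insert h (U - P))"
        by (rule Cut2_insert(2)[OF P(3)]) (use P(4) h in \<open>auto simp: crossing_def\<close>)
      moreover have "insert h (U - P) = U - {k}" using h P by auto
      ultimately show ?thesis by simp
    qed
    obtain k\<^sub>0 where k0: "k\<^sub>0 \<in> P\<^sub>0" using P0 by (auto simp: card_2_iff)
    then have k0U: "k\<^sub>0 \<in> U" "Tree (U - {k\<^sub>0})" using P0 TreeU by auto
    define Z where "Z = circuit U"
    have Z: "Z = {h\<in>U. Tree (U - {h})}"
      unfolding Z_def by (rule circuit_eq_Tree[OF k0U UE])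
    have sumZ: "(\<Sum>h\<in>Z. cobd X h) = 0" for X
      unfolding Z_def using cobd_sum_circuit[OF k0U(1) Tree_indep[OF k0U(2)]
          Tree_insert_dependent[OF k0U UE]] k0U UE by auto
    have finZ: "finite Z" using Z finU by simp
    \<comment> \<open>Removing two circuit edges always yields a 2-forest crossed by both; only the
      condition on the complement remains.\<close>
    have KZ: "?K U = {P. P \<subseteq> Z \<and> card P = 2 \<and> Tree ((E - U) \<union> P)}"
    proof (intro equalityI subsetI)
      fix P assume P: "P \<in> ?K U"
      have "E - (U - P) = (E - U) \<union> P" using P UE by auto
      then show "P \<in> {P. P \<subseteq> Z \<and> card P = 2 \<and> Tree ((E - U) \<union> P)}"
        using P TreeU[OF P] by (auto simp: Z)
    next
      fix P assume P: "P \<in> {P. P \<subseteq> Z \<and> card P = 2 \<and> Tree ((E - U) \<union> P)}"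
      then have PU: "P \<subseteq> U" using Z by auto
      have "E - (U - P) = (E - U) \<union> P" using PU UE by auto
      moreover have "Cut2 (U - P) (side (U - P)) \<and> cobd (ind (side (U - P))) k = 1" if k: "k \<in> P" for k
      proof -
        obtain h where h: "P = {k, h}" "h \<noteq> k" using P k by (auto simp: card_2_iff)
        have "Tree (U - {h})" using P h Z by auto
        moreover have "U - {h} - {k} = U - P" using h by auto
        ultimately show ?thesis using Tree_remove[of "U - {h}" k] h PU by auto
      qed
      moreover have "P \<noteq> {}" using P by auto
      ultimately show "P \<in> ?K U" using P PU UE unfolding crossing_def by auto
    qed
    \<comment> \<open>\<open>q\<close> is the indicator of the path from \<open>r\<close> to \<open>u\<close> in the tree \<open>U - k\<^sub>0\<close>.\<close>
    define q where "q e = (if e = k\<^sub>0 then 0 else ind (side (U - {k\<^sub>0} - {e})) u)" for e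
    have val: "ind (side (U - P)) u = (\<Sum>h\<in>P. q h)" if P: "P \<in> ?K U" for P
    proof -
      let ?X = "ind (side (U - P))"
      have finP: "finite P" using P finU finite_subset by auto
      have dX: "cobd ?X e = of_bool (e \<in> P)" if "e \<in> U" for e
        using that P by (auto simp: crossing_def Cut2_def constant_along_def)
      have "?X u = ?X r + (\<Sum>e\<in>U - {k\<^sub>0}. cobd ?X e * ind (side (U - {k\<^sub>0} - {e})) u)"
        by (rule Tree_expansion[OF k0U(2) u])
      also have "?X r = 0" by (simp add: ind_def side_def)
      also have "(\<Sum>e\<in>U - {k\<^sub>0}. cobd ?X e * ind (side (U - {k\<^sub>0} - {e})) u) =
          (\<Sum>e\<in>P - {k\<^sub>0}. cobd ?X e * ind (side (U - {k\<^sub>0} - {e})) u)"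
        by (rule sum.mono_neutral_right) (use finU P dX in auto)
      also have "\<dots> = (\<Sum>e\<in>P - {k\<^sub>0}. q e)"
        by (rule sum.cong) (use P dX in \<open>auto simp: q_def\<close>)
      also have "\<dots> = (\<Sum>e\<in>P. q e)"
        by (rule sum.mono_neutral_left) (auto simp: q_def finP)
      finally show ?thesis by simp
    qed
    \<comment> \<open>After exchanging the sums over pairs and over their members, it suffices that
      each circuit edge \<open>h\<close> lies in an even number of admissible pairs.\<close>
    have count: "of_nat (card {P\<in>?K U. h \<in> P}) = (0::bit)" if h: "h \<in> Z" for h
    proof -
      define F where "F = insert h (E - U)"
      let ?N = "{h'\<in>Z - {h}. Tree (insert h' F)}"
      have "bij_betw (\<lambda>h'. {h, h'}) ?N {P\<in>?K U. h \<in> P}"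
        unfolding KZ bij_betw_def
      proof
        show "inj_on (\<lambda>h'. {h, h'}) ?N" by (auto simp: inj_on_def doubleton_eq_iff)
        have eq: "(E - U) \<union> {h, h'} = insert h' F" for h' by (auto simp: F_def)
        show "(\<lambda>h'. {h, h'}) ` ?N = {P \<in> {P. P \<subseteq> Z \<and> card P = 2 \<and> Tree (E - U \<union> P)}. h \<in> P}"
        proof (intro equalityI subsetI)
          fix P assume "P \<in> {P \<in> {P. P \<subseteq> Z \<and> card P = 2 \<and> Tree (E - U \<union> P)}. h \<in> P}"
          then have P: "P \<subseteq> Z" "card P = 2" "Tree (E - U \<union> P)" "h \<in> P" by auto
          obtain h' where h': "P = {h, h'}" "h' \<noteq> h" using P by (auto simp: card_2_iff)
          then have "h' \<in> ?N" using P eq[of h'] by auto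
          then show "P \<in> (\<lambda>h'. {h, h'}) ` ?N" using h' by blast
        next
          fix P assume "P \<in> (\<lambda>h'. {h, h'}) ` ?N"
          then obtain h' where "P = {h, h'}" "h' \<in> ?N" by blast
          then show "P \<in> {P \<in> {P. P \<subseteq> Z \<and> card P = 2 \<and> Tree (E - U \<union> P)}. h \<in> P}"
            using h eq[of h'] by auto
        qed
      qed
      then have "card {P\<in>?K U. h \<in> P} = card ?N" by (simp add: bij_betw_same_card)
      also have "of_nat (card ?N) = (0::bit)"
      proof (cases "?N = {}")
        case False
        then obtain k where k: "k \<in> Z" "k \<noteq> h" "Tree (insert k F)" by blast
        then have "insert k F - {k} = F" using Z by (auto simp: F_def)
        then have F: "Cut2 F (side F)" using Tree_remove(1)[OF k(3), of k] by simp
        have "Tree (insert h' F) \<longleftrightarrow> cobd (ind (side F)) h' = 1" if "h' \<in> Z" for h'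
          using Cut2_insert(2)[OF F] Cut2_insert_Tree_crosses[OF F] that Z UE by auto
        \<comment> \<open>Because \<open>h\<close> belongs to \<open>F\<close> it does not cross, so
          the partners of \<open>h\<close> are all circuit edges crossing \<open>side F\<close>, an
          even number.\<close>
        moreover have "cobd (ind (side F)) h = 0"
          using F by (auto simp: F_def Cut2_def constant_along_def)
        ultimately have "?N = {h'\<in>Z. cobd (ind (side F)) h' = 1}" by auto
        then show ?thesis using of_nat_card_bit[OF finZ] sumZ by simp
      qed (simp only: card.empty of_nat_0)
      finally show ?thesis .
    qed
    have finK: "finite (?K U)" by (rule finite_subset[of _ "Pow U"]) (use finU in auto)
    have "(\<Sum>P\<in>?K U. ind (side (U - P)) u) = (\<Sum>P\<in>?K U. \<Sum>h\<in>Z. if h \<in> P then q h else 0)"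
    proof (rule sum.cong[OF refl])
      fix P assume P: "P \<in> ?K U"
      then have "P \<subseteq> Z" unfolding KZ by blast
      then have "{h\<in>Z. h \<in> P} = P" by blast
      then show "ind (side (U - P)) u = (\<Sum>h\<in>Z. if h \<in> P then q h else 0)"
        unfolding val[OF P] using finZ by (simp flip: sum.inter_filter)
    qed
    also have "\<dots> = (\<Sum>h\<in>Z. \<Sum>P\<in>?K U. if h \<in> P then q h else 0)" by (rule sum.swap)
    also have "\<dots> = (\<Sum>h\<in>Z. \<Sum>P\<in>{P\<in>?K U. h \<in> P}. q h)"
      by (rule sum.cong[OF refl], rule sum.inter_filter[symmetric], rule finK)
    also have "\<dots> = (\<Sum>h\<in>Z. of_nat (card {P\<in>?K U. h \<in> P}) * q h)" by (simp only: sum_constant)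
    also have "\<dots> = 0" by (rule sum.neutral) (use count in auto)
    finally show ?thesis .
  qed (simp only: sum.empty)
  have "(\<Sum>\<phi>\<in>Conf. of_nat (card (crossing \<phi>) choose 2) * ind (side \<phi>) u) =
      (\<Sum>\<phi>\<in>Conf. \<Sum>P\<in>?I \<phi>. ind (side \<phi>) u)"
    by (simp add: n_subsets finite_crossing)
  also have "\<dots> = (\<Sum>(\<phi>, P)\<in>Sigma Conf ?I. ind (side \<phi>) u)"
    by (rule sum.Sigma) (auto simp: finite_Conf finite_crossing)
  also have "\<dots> = (\<Sum>(U, P)\<in>Sigma (Pow E) ?K. ind (side (U - P)) u)"
  proof (rule sum.reindex_bij_witness[where j = "\<lambda>(\<phi>, P). (\<phi> \<union> P, P)" and i = "\<lambda>(U, P). (U - P, P)"])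
    fix p assume "p \<in> Sigma Conf ?I"
    then obtain \<phi> P where p: "p = (\<phi>, P)" "\<phi> \<in> Conf" "P \<subseteq> crossing \<phi>" "card P = 2" by auto
    have "\<phi> \<inter> P = {}" using swap_Conf(4)[OF p(2)] p(3) by blast
    then have eq: "(\<phi> \<union> P) - P = \<phi>" by auto
    show "(case case p of (\<phi>, P) \<Rightarrow> (\<phi> \<union> P, P) of (U, P) \<Rightarrow> (U - P, P)) = p"
      and "(case p of (\<phi>, P) \<Rightarrow> (\<phi> \<union> P, P)) \<in> Sigma (Pow E) ?K"
      and "(case case p of (\<phi>, P) \<Rightarrow> (\<phi> \<union> P, P) of (U, P) \<Rightarrow> ind (side (U - P)) u) =
         (case p of (\<phi>, P) \<Rightarrow> ind (side \<phi>) u)"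
      using p eq by (auto simp: Conf_def crossing_def)
  next
    fix p assume "p \<in> Sigma (Pow E) ?K"
    then show "(case case p of (U, P) \<Rightarrow> (U - P, P) of (\<phi>, P) \<Rightarrow> (\<phi> \<union> P, P)) = p"
      and "(case p of (U, P) \<Rightarrow> (U - P, P)) \<in> Sigma Conf ?I"
      by (auto simp: Conf_def)
  qed
  also have "\<dots> = (\<Sum>U\<in>Pow E. \<Sum>P\<in>?K U. ind (side (U - P)) u)"
  proof (rule sum.Sigma[symmetric])
    show "\<forall>U\<in>Pow E. finite (?K U)"
    proof
      fix U assume "U \<in> Pow E"
      then show "finite (?K U)"
        by (intro finite_subset[of "?K U" "Pow E"]) (use finite_E in auto)
    qed
  qed (simp add: finite_E)
  also have "\<dots> = 0" by (rule sum.neutral) (use K in blast)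
  finally show ?thesis .
qed

end

section \<open>Degree counts and parities\<close>

text \<open>Translates the binomial term into a residue modulo 4, where the degree count can be
  compared with it.\<close>

lemma odd_choose_2_iff: "odd (n choose 2) \<longleftrightarrow> n mod 4 \<in> {2, 3}"
proof (induction n)
  case (Suc n)
  have "Suc n choose 2 = n + (n choose 2)" by (simp add: numeral_2_eq_2)
  then have "odd (Suc n choose 2) \<longleftrightarrow> (odd n \<longleftrightarrow> \<not> n mod 4 \<in> {2, 3})" using Suc by auto
  also have "\<dots> \<longleftrightarrow> Suc n mod 4 \<in> {2, 3}" by simp presburger
  finally show ?case .
qed (simp add: numeral_2_eq_2)

context rooted_graph
begin

text \<open>A trace argument: with duals \<open>D e\<close> normalised at a vertex \<open>x\<^sub>0\<close> of \<open>W\<close>, the indicator of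
  \<open>x \<in> W\<close> equals \<open>\<Sum>e. [x \<in> e] D e\<close> up to a constant, and summing its value at \<open>x\<close> over \<open>W\<close> counts
  the edges because \<open>cobd (D e) e = 1\<close>.\<close>

lemma card_inside_Cut2:
  assumes "Cut2 \<phi> W"
  shows "(of_nat (card {e\<in>\<phi>. en e \<subseteq> W}) :: bit) + 1 = of_nat (card W)"
proof -
  have W: "W \<subseteq> V" "W \<noteq> {}" and \<phi>: "\<phi> \<subseteq> E" "finite \<phi>"
    using assms indep_finite indep_subset_E by (auto simp: Cut2_def)
  have finW: "finite W" using W finite_V finite_subset by blast
  define I where "I = {e\<in>\<phi>. en e \<subseteq> W}"
  have finI: "finite I" using \<phi> by (simp add: I_def)
  have io: "en e \<subseteq> W \<or> en e \<inter> W = {}" if "e \<in> \<phi>" for e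
    using cobd_ind_eq_0_iff[of e W] that \<phi> assms by (auto simp: Cut2_def constant_along_def)
  obtain x\<^sub>0 where x0: "x\<^sub>0 \<in> W" using W by blast
  obtain D0 where D0: "\<And>e. e \<in> \<phi> \<Longrightarrow> dual_on \<phi> e (D0 e)"
    using assms unfolding Cut2_def indep_def by metis
  \<comment> \<open>Each dual is shifted to vanish at \<open>x\<^sub>0\<close> and extended by 0
    outside \<open>W\<close>; no edge of \<open>\<phi>\<close> crosses \<open>W\<close>, so duality
    survives for edges inside \<open>W\<close>.\<close>
  define D where "D e x = (if x \<in> W then D0 e x + D0 e x\<^sub>0 else 0)" for e x
  have D: "cobd (D e) e' = of_bool (e' = e)" if "e \<in> I" "e' \<in> \<phi>" for e e'
  proof (cases "en e' \<subseteq> W")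
    case True
    then have "cobd (D e) e' = cobd (\<lambda>x. D0 e x + D0 e x\<^sub>0) e'"
      unfolding cobd_def D_def by (intro sum.cong) auto
    also have "\<dots> = cobd (D0 e) e'" using that \<phi> by auto
    finally show ?thesis using D0[of e] that by (auto simp: dual_on_def I_def)
  next
    case False
    then have "cobd (D e) e' = 0"
      using io[OF that(2)] by (auto simp: cobd_def D_def intro!: sum.neutral)
    then show ?thesis using False that by (auto simp: I_def)
  qed
  have key: "of_bool (x = x\<^sub>0) + (\<Sum>e\<in>I. of_bool (x \<in> en e) * D e x) = (1::bit)" if x: "x \<in> W" for x
  proof -
    \<comment> \<open>The coboundaries of the two summands cancel on \<open>\<phi>\<close>, so
      \<open>?Y\<close> is constant on \<open>W\<close>, and comparing \<open>x\<close> with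
      \<open>x\<^sub>0\<close> gives the claim.\<close>
    let ?Y = "\<lambda>y. ind {x} y + (\<Sum>e\<in>I. of_bool (x \<in> en e) * D e y)"
    have "constant_along \<phi> ?Y"
      unfolding constant_along_def
    proof
      fix e' assume e': "e' \<in> \<phi>"
      have fin: "finite (en e')" using e' \<phi> card_en by (intro card_ge_0_finite) auto
      have "cobd (ind {x}) e' = of_bool (x \<in> en e')"
        using fin by (simp add: cobd_def ind_def)
      moreover have "(\<Sum>e\<in>I. of_bool (x \<in> en e) * cobd (D e) e') =
          (\<Sum>e\<in>I. if e = e' then of_bool (x \<in> en e') else 0)"
        by (rule sum.cong) (use D e' in auto)
      moreover have "\<dots> = of_bool (x \<in> en e')"
        using finI io[OF e'] e' x by (auto simp: I_def)
      ultimately show "cobd ?Y e' = 0" by simp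
    qed
    then obtain c where c: "\<forall>y\<in>V. ?Y y = ?Y r + c * ind W y"
      using assms unfolding Cut2_def by blast
    have "?Y x = ?Y r + c * ind W x" "?Y x\<^sub>0 = ?Y r + c * ind W x\<^sub>0"
      using bspec[OF c, of x] bspec[OF c, of x\<^sub>0] x x0 W by blast+
    then have "?Y x = ?Y x\<^sub>0" using x x0 by (simp add: ind_def)
    moreover have "?Y x\<^sub>0 = of_bool (x = x\<^sub>0)" using x0 by (auto simp: ind_def D_def)
    moreover have "ind {x} x = 1" by (simp add: ind_def)
    ultimately have "1 + (\<Sum>e\<in>I. of_bool (x \<in> en e) * D e x) = of_bool (x = x\<^sub>0)" by simp
    then show ?thesis by (metis add.commute add.left_commute bit_add_self(1) add.right_neutral)
  qed
  have "of_nat (card W) = (\<Sum>x\<in>W. (1::bit))" by simp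
  also have "\<dots> = (\<Sum>x\<in>W. of_bool (x = x\<^sub>0) + (\<Sum>e\<in>I. of_bool (x \<in> en e) * D e x))"
    by (rule sum.cong) (use key in auto)
  also have "\<dots> = 1 + (\<Sum>x\<in>W. \<Sum>e\<in>I. of_bool (x \<in> en e) * D e x)"
    using x0 finW by (simp add: sum.distrib)
  also have "(\<Sum>x\<in>W. \<Sum>e\<in>I. of_bool (x \<in> en e) * D e x) = (\<Sum>e\<in>I. \<Sum>x\<in>W. of_bool (x \<in> en e) * D e x)"
    by (rule sum.swap)
  also have "\<dots> = (\<Sum>e\<in>I. 1)"
  proof (rule sum.cong[OF refl])
    fix e assume e: "e \<in> I"
    have "(\<Sum>x\<in>W. of_bool (x \<in> en e) * D e x) = (\<Sum>x\<in>en e. of_bool (x \<in> en e) * D e x)"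
      by (rule sum.mono_neutral_right) (use e finW in \<open>auto simp: I_def\<close>)
    also have "\<dots> = cobd (D e) e" by (auto simp: cobd_def)
    also have "\<dots> = 1" using D[OF e, of e] e by (auto simp: I_def)
    finally show "(\<Sum>x\<in>W. of_bool (x \<in> en e) * D e x) = 1" .
  qed
  finally show ?thesis by (simp add: I_def)
qed

text \<open>Double counting: an edge contributes the number of its ends in \<open>W\<close>.\<close>

lemma sum_degrees:
  assumes "W \<subseteq> V"
  shows "(\<Sum>x\<in>W. card {e\<in>E. x \<in> en e}) =
    card {e\<in>E. cobd (ind W) e = 1} + 2 * card {e\<in>E. en e \<subseteq> W}"
proof -
  have finW: "finite W" using assms finite_V finite_subset by blast
  have "(\<Sum>x\<in>W. card {e\<in>E. x \<in> en e}) = (\<Sum>x\<in>W. \<Sum>e\<in>E. of_bool (x \<in> en e))"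
    by (simp add: finite_E sum.If_cases Int_def)
  also have "\<dots> = (\<Sum>e\<in>E. \<Sum>x\<in>W. of_bool (x \<in> en e))" by (rule sum.swap)
  also have "\<dots> = (\<Sum>e\<in>E. of_bool (cobd (ind W) e = 1) + 2 * of_bool (en e \<subseteq> W))"
  proof (rule sum.cong[OF refl])
    fix e assume e: "e \<in> E"
    obtain x y where xy: "en e = {x, y}" "x \<noteq> y"
      using card_en[OF e] by (auto simp: card_2_iff)
    have "W \<inter> en e = (if x \<in> W then {x} else {}) \<union> (if y \<in> W then {y} else {})" using xy by auto
    moreover have "cobd (ind W) e = of_bool (x \<in> W) + of_bool (y \<in> W)"
      using xy by (simp add: cobd_def ind_def)
    ultimately have "card (W \<inter> en e) = of_bool (cobd (ind W) e = 1) + 2 * of_bool (en e \<subseteq> W)"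
      using xy by (cases "x \<in> W"; cases "y \<in> W") simp_all
    then show "(\<Sum>x\<in>W. of_bool (x \<in> en e)) = of_bool (cobd (ind W) e = 1) + 2 * (of_bool (en e \<subseteq> W) :: nat)"
      using finW by (simp add: Int_def)
  qed
  also have "\<dots> = card {e\<in>E. cobd (ind W) e = 1} + 2 * card {e\<in>E. en e \<subseteq> W}"
    by (simp add: sum.distrib finite_E Int_def flip: sum_distrib_left)
  finally show ?thesis .
qed

end

text \<open>Models \<open>R\<close>: the six neighbours in \<open>S\<close> have each lost one edge
  to \<open>v\<close> or \<open>w\<close>.\<close>

locale four_regular_minus_edge = rooted_graph +
  fixes S
  assumes S_subset: "S \<subseteq> V" and root_in_S: "r \<in> S" and card_S: "card S = 6"
    and degree: "x \<in> V \<Longrightarrow> card {e\<in>E. x \<in> en e} + of_bool (x \<in> S) = 4"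
begin

lemma finite_S: "finite S"
  using S_subset finite_V finite_subset by blast

text \<open>The degree sum gives \<open>n + k = 2 * (i + p)\<close> modulo 4, where \<open>i\<close>
  has the parity of \<open>card W + 1\<close>. For odd \<open>k\<close> this decides whether
  \<open>k\<close> is 1 or 3 modulo 4, with the binomial reading off the residue of
  \<open>n\<close>.\<close>

lemma Conf_count:
  assumes "\<phi> \<in> Conf"
  defines "W \<equiv> side \<phi>"
  defines "k \<equiv> card (W \<inter> S)" and "n \<equiv> card (crossing \<phi>)" and "p \<equiv> card {g\<in>E - \<phi>. en g \<subseteq> W}"
  shows "(of_nat k :: bit) = of_nat n"
    and "(of_bool (k = 1 \<or> k = 5) :: bit) =
      of_nat k + of_nat (n choose 2) * of_nat k + of_nat k * of_nat (card W) + of_nat k * of_nat p"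
proof -
  have C: "Cut2 \<phi> W" and \<phi>: "\<phi> \<subseteq> E" using assms by (auto simp: Conf_def)
  then have W: "W \<subseteq> V" "r \<notin> W" by (auto simp: Cut2_def)
  have finW: "finite W" using W finite_V finite_subset by blast
  define i where "i = card {e\<in>\<phi>. en e \<subseteq> W}"
  have "card ({e\<in>\<phi>. en e \<subseteq> W} \<union> {g\<in>E - \<phi>. en g \<subseteq> W}) = i + p"
    unfolding i_def p_def by (rule card_Un_disjoint) (use \<phi> finite_E in \<open>auto intro: rev_finite_subset\<close>)
  moreover have "{e\<in>\<phi>. en e \<subseteq> W} \<union> {g\<in>E - \<phi>. en g \<subseteq> W} = {e\<in>E. en e \<subseteq> W}" using \<phi> by auto
  ultimately have ip: "card {e\<in>E. en e \<subseteq> W} = i + p" by simp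
  have "(\<Sum>x\<in>W. card {e\<in>E. x \<in> en e}) + k = (\<Sum>x\<in>W. card {e\<in>E. x \<in> en e} + of_bool (x \<in> S))"
    using finW by (simp add: sum.distrib k_def Int_def)
  also have "\<dots> = (\<Sum>x\<in>W. 4)" by (rule sum.cong[OF refl], rule degree) (use W in blast)
  finally have eq: "n + 2 * (i + p) + k = 4 * card W"
    using sum_degrees[OF W(1)] ip by (simp add: n_def crossing_def W_def)
  have i: "odd i \<longleftrightarrow> even (card W)"
    using card_inside_Cut2[OF C] by (cases "odd i"; cases "odd (card W)")
      (auto simp: i_def of_nat_bit_eq_of_bool)
  \<comment> \<open>The root lies in \<open>S\<close> but not in \<open>W\<close>; so
    \<open>k\<close> is at most 5, and 1 and 5 are the only values congruent to 1 modulo 4.\<close>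
  have "W \<inter> S \<subset> S" using root_in_S W by auto
  then have "k < 6" unfolding k_def card_S[symmetric] by (rule psubset_card_mono[OF finite_S])
  then have k: "k = 0 \<or> k = 1 \<or> k = 2 \<or> k = 3 \<or> k = 4 \<or> k = 5" by arith
  have "odd k \<longleftrightarrow> odd n" using eq by presburger
  then show "(of_nat k :: bit) = of_nat n" by (simp add: of_nat_bit_eq_of_bool)
  define w where "w = card W"
  have n: "odd (n choose 2) \<longleftrightarrow> n mod 4 = 2 \<or> n mod 4 = 3" using odd_choose_2_iff[of n] by simp
  define m where "m = i + p"
  have m: "odd m \<longleftrightarrow> (odd w \<longleftrightarrow> odd p)" using i by (auto simp: m_def w_def)
  have eq': "n + 2 * m + k = 4 * w" using eq by (simp add: m_def w_def)
  have "(n + k) mod 4 = (if odd m then 2 else 0)"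
  proof (cases "odd m")
    case True
    then obtain j where "m = 2 * j + 1" by (auto elim: oddE)
    then have "n + k + 4 * j + 2 = 4 * w" using eq' by simp
    then show ?thesis using True by simp presburger
  next
    case False
    then obtain j where "m = 2 * j" by (auto elim: evenE)
    then have "n + k + 4 * j = 4 * w" using eq' by simp
    then show ?thesis using False by simp presburger
  qed
  then have nk: "(n + k) mod 4 = 2 \<and> odd m \<or> (n + k) mod 4 = 0 \<and> even m" by auto
  have "(k = 1 \<or> k = 5) \<longleftrightarrow> odd k \<and> (odd (n choose 2) \<longleftrightarrow> even m)"
    unfolding n using k
  proof (elim disjE)
    assume "k = 1"
    moreover have "n mod 4 = 1 \<and> odd m \<or> n mod 4 = 3 \<and> even m"
      using nk unfolding \<open>k = 1\<close> by presburger
    ultimately show "(k = 1 \<or> k = 5) \<longleftrightarrow> odd k \<and> ((n mod 4 = 2 \<or> n mod 4 = 3) \<longleftrightarrow> even m)" by auto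
  next
    assume "k = 5"
    moreover have "n mod 4 = 1 \<and> odd m \<or> n mod 4 = 3 \<and> even m"
      using nk unfolding \<open>k = 5\<close> by presburger
    ultimately show "(k = 1 \<or> k = 5) \<longleftrightarrow> odd k \<and> ((n mod 4 = 2 \<or> n mod 4 = 3) \<longleftrightarrow> even m)" by auto
  next
    assume "k = 3"
    moreover have "n mod 4 = 3 \<and> odd m \<or> n mod 4 = 1 \<and> even m"
      using nk unfolding \<open>k = 3\<close> by presburger
    ultimately show "(k = 1 \<or> k = 5) \<longleftrightarrow> odd k \<and> ((n mod 4 = 2 \<or> n mod 4 = 3) \<longleftrightarrow> even m)" by auto
  qed auto
  then show "(of_bool (k = 1 \<or> k = 5) :: bit) =
      of_nat k + of_nat (n choose 2) * of_nat k + of_nat k * of_nat (card W) + of_nat k * of_nat p"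
    unfolding w_def[symmetric] of_nat_bit_eq_of_bool using m by auto
qed

lemma even_card_Conf_1_5:
  "even (card {\<phi>\<in>Conf. card (side \<phi> \<inter> S) = 1 \<or> card (side \<phi> \<inter> S) = 5})"
proof -
  \<comment> \<open>The root has degree 3 in \<open>R\<close>, which supplies the second edge needed
    for pairing configurations.\<close>
  have E1: "E \<noteq> {e}" for e
  proof
    assume *: "E = {e}"
    have "card {e\<in>E. r \<in> en e} \<le> card E" by (rule card_mono) (use finite_E in auto)
    moreover have "card {e\<in>E. r \<in> en e} \<ge> 3" using degree[OF root_in_V] root_in_S by simp
    ultimately show False using * by simp
  qed
  let ?k = "\<lambda>\<phi>. of_nat (card (side \<phi> \<inter> S)) :: bit" and ?n = "\<lambda>\<phi>. card (crossing \<phi>)"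
    and ?w = "\<lambda>\<phi>. of_nat (card (side \<phi>)) :: bit"
    and ?p = "\<lambda>\<phi>. of_nat (card {g\<in>E - \<phi>. en g \<subseteq> side \<phi>}) :: bit"
  have k: "?k \<phi> = (\<Sum>u\<in>S. ind (side \<phi>) u)" for \<phi>
    using finite_S by (simp add: ind_def Int_commute Int_def)
  have w: "?w \<phi> = (\<Sum>u\<in>V. ind (side \<phi>) u)" for \<phi>
  proof -
    have "side \<phi> = V \<inter> side \<phi>" by (auto simp: side_def)
    then show ?thesis using finite_V by (simp add: ind_def)
  qed
  have s1: "(\<Sum>\<phi>\<in>Conf. ?k \<phi>) = 0"
    unfolding k by (subst sum.swap, rule sum.neutral) (use sum_Conf_side[OF E1] S_subset in auto)
  have s2: "(\<Sum>\<phi>\<in>Conf. of_nat (?n \<phi> choose 2) * ?k \<phi>) = 0"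
    unfolding k sum_distrib_left
    by (subst sum.swap, rule sum.neutral) (use sum_Conf_pairs_side S_subset in auto)
  \<comment> \<open>\<open>k\<close> may be replaced by the number of crossing edges, which has the
    same parity.\<close>
  have "(\<Sum>\<phi>\<in>Conf. ?k \<phi> * ?w \<phi>) = (\<Sum>\<phi>\<in>Conf. of_nat (?n \<phi>) * ?w \<phi>)"
    by (rule sum.cong) (auto simp: Conf_count(1))
  also have "\<dots> = 0"
    unfolding w sum_distrib_left
    by (subst sum.swap, rule sum.neutral) (use sum_Conf_crossing_side sum_Conf_side[OF E1] in auto)
  finally have s3: "(\<Sum>\<phi>\<in>Conf. ?k \<phi> * ?w \<phi>) = 0" .
  \<comment> \<open>For fixed \<open>side \<phi>\<close> the factor \<open>k\<close> is constant and
    the counts of inner edges already sum to 0.\<close>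
  have "(\<Sum>\<phi>\<in>Conf. ?k \<phi> * ?p \<phi>) = (\<Sum>W\<in>Pow V. \<Sum>\<phi>\<in>{\<phi>\<in>Conf. side \<phi> = W}. ?k \<phi> * ?p \<phi>)"
    by (rule sum.group[symmetric]) (auto simp: finite_Conf finite_V side_def)
  also have "\<dots> = (\<Sum>W\<in>Pow V. of_nat (card (W \<inter> S)) *
      (\<Sum>\<phi>\<in>{\<phi>\<in>Conf. side \<phi> = W}. of_nat (card {g\<in>E - \<phi>. en g \<subseteq> W})))"
    by (auto simp: sum_distrib_left intro!: sum.cong)
  also have "\<dots> = 0" by (simp only: sum_Conf_inside mult_zero_right sum.neutral_const)
  finally have s4: "(\<Sum>\<phi>\<in>Conf. ?k \<phi> * ?p \<phi>) = 0" .
  have "of_nat (card {\<phi>\<in>Conf. card (side \<phi> \<inter> S) = 1 \<or> card (side \<phi> \<inter> S) = 5}) =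
      (\<Sum>\<phi>\<in>Conf. of_bool (card (side \<phi> \<inter> S) = 1 \<or> card (side \<phi> \<inter> S) = 5) :: bit)"
    using finite_Conf by (simp add: Int_def)
  also have "\<dots> = (\<Sum>\<phi>\<in>Conf. ?k \<phi> + of_nat (?n \<phi> choose 2) * ?k \<phi> + ?k \<phi> * ?w \<phi> + ?k \<phi> * ?p \<phi>)"
    by (rule sum.cong) (use Conf_count(2) in auto)
  also have "\<dots> = 0" using s1 s2 s3 s4 by (simp add: sum.distrib)
  finally show ?thesis by (simp add: of_nat_bit_eq_of_bool)
qed

end

subsection \<open>Comparison with cycles and components\<close>

lemma rtranclp_distinct_path:
  assumes "r\<^sup>*\<^sup>* x y"
  shows "\<exists>xs. xs \<noteq> [] \<and> hd xs = x \<and> last xs = y \<and> distinct xs \<and>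
    (\<forall>i. Suc i < length xs \<longrightarrow> r (xs ! i) (xs ! Suc i))"
  using assms
proof (induction rule: rtranclp_induct)
  case base
  show ?case by (intro exI[of _ "[x]"]) auto
next
  case (step y z)
  then obtain xs where xs: "xs \<noteq> []" "hd xs = x" "last xs = y" "distinct xs"
    "\<And>i. Suc i < length xs \<Longrightarrow> r (xs ! i) (xs ! Suc i)" by blast
  show ?case
  proof (cases "z \<in> set xs")
    case True
    then obtain i where i: "i < length xs" "xs ! i = z" by (auto simp: in_set_conv_nth)
    \<comment> \<open>A step back onto the path is absorbed by truncating at the earlier
      visit.\<close>
    then have "last (take (Suc i) xs) = z" by (simp add: take_Suc_conv_app_nth)
    then show ?thesis using xs i by (intro exI[of _ "take (Suc i) xs"]) (auto simp: hd_take)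
  next
    case False
    have "r ((xs @ [z]) ! i) ((xs @ [z]) ! Suc i)" if "Suc i < length (xs @ [z])" for i
    proof (cases "Suc i < length xs")
      case True
      then show ?thesis using xs(5)[of i] by (simp add: nth_append)
    next
      case False
      then have "Suc i = length xs" using that by simp
      moreover from this have "xs ! i = y" using xs(1,3) by (metis diff_Suc_1 last_conv_nth)
      ultimately show ?thesis using step(2) by (simp add: nth_append)
    qed
    then show ?thesis using xs False by (intro exI[of _ "xs @ [z]"]) auto
  qed
qed

context rooted_graph
begin

abbreviation sub :: "'e set \<Rightarrow> ('v, 'e) mgraph" where
  "sub F \<equiv> \<lparr>verts = V, edges = F, ends = en\<rparr>"

definition comp :: "'e set \<Rightarrow> 'v \<Rightarrow> 'v set" where
  "comp F x = {y\<in>V. (adjacent (sub F))\<^sup>*\<^sup>* x y}"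

lemma cobd_doubleton:
  assumes "e \<in> E" "en e = {x, y}"
  shows "cobd X e = X x + X y"
proof -
  have "x \<noteq> y" using card_en[OF assms(1)] assms(2) by auto
  then show ?thesis by (simp add: cobd_def assms(2))
qed

lemma constant_along_reachable:
  assumes "constant_along F X" "F \<subseteq> E" "(adjacent (sub F))\<^sup>*\<^sup>* x y"
  shows "X x = X y"
  using assms(3)
proof (induction rule: rtranclp_induct)
  case (step y z)
  then obtain e where e: "e \<in> F" "en e = {y, z}" by (auto simp: adjacent_def)
  then have "cobd X e = X y + X z" using cobd_doubleton assms by blast
  then have "X y = X z" using assms e by (auto simp: constant_along_def bit_add_eq_0_iff)
  then show ?case using step by simp
qed simp

lemma constant_along_comp:
  assumes "F \<subseteq> E"
  shows "constant_along F (ind (comp F x))"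
  unfolding constant_along_def
proof
  fix e assume e: "e \<in> F"
  then have eE: "e \<in> E" using assms by auto
  obtain y z where yz: "en e = {y, z}"
    using card_en[OF eE] by (auto simp: card_2_iff)
  have "adjacent (sub F) y z" "adjacent (sub F) z y"
    using e yz by (auto simp: adjacent_def insert_commute)
  then have "y \<in> comp F x \<longleftrightarrow> z \<in> comp F x"
    using en_subset[OF eE] yz by (auto simp: comp_def intro: rtranclp.rtrancl_into_rtrancl)
  then show "cobd (ind (comp F x)) e = 0"
    using cobd_doubleton[OF eE yz] by (simp add: ind_def)
qed

text \<open>The dual of the first edge would have coboundary sum 1 around the cycle, yet every
  vertex value occurs twice in that sum.\<close>

lemma cycle_dependent:
  assumes "F \<subseteq> E" "is_cycle (sub F) xs es"
  shows "\<not> indep F"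
proof
  assume "indep F"
  define n where "n = length xs"
  have c: "n > 0" "length es = n" "distinct es" "set es \<subseteq> F"
    "\<And>i. i < n \<Longrightarrow> en (es ! i) = {xs ! i, xs ! (Suc i mod n)}"
    using assms by (auto simp: is_cycle_def n_def)
  then have e0: "es ! 0 \<in> F" by auto
  obtain X where X: "dual_on F (es ! 0) X" using \<open>indep F\<close> e0 unfolding indep_def by blast
  have "(\<Sum>i<n. cobd X (es ! i)) = (\<Sum>i<n. if i = 0 then 1 else 0)"
  proof (rule sum.cong[OF refl])
    fix i assume i: "i \<in> {..<n}"
    then have "es ! i \<in> F" using c by auto
    moreover have "es ! i = es ! 0 \<longleftrightarrow> i = 0" using i c by (auto simp: nth_eq_iff_index_eq)
    ultimately show "cobd X (es ! i) = (if i = 0 then 1 else 0)"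
      using X by (auto simp: dual_on_def)
  qed
  also have "\<dots> = 1" using c(1) by simp
  finally have 1: "(\<Sum>i<n. cobd X (es ! i)) = 1" .
  have "cobd X (es ! i) = X (xs ! i) + X (xs ! (Suc i mod n))" if i: "i < n" for i
  proof (rule cobd_doubleton)
    show "es ! i \<in> E" using nth_mem[of i es] i c(2,4) assms(1) by blast
  qed (use i c in blast)
  then have "(\<Sum>i<n. cobd X (es ! i)) = (\<Sum>i<n. X (xs ! i)) + (\<Sum>i<n. X (xs ! (Suc i mod n)))"
    by (simp add: sum.distrib)
  also have "(\<Sum>i<n. X (xs ! (Suc i mod n))) = (\<Sum>i<n. X (xs ! i))"
  proof -
    obtain m where m: "n = Suc m" using c(1) by (cases n) auto
    have "(\<Sum>i<n. X (xs ! (Suc i mod n))) = (\<Sum>i<m. X (xs ! (Suc i mod n))) + X (xs ! 0)"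
      by (simp add: m)
    also have "(\<Sum>i<m. X (xs ! (Suc i mod n))) = (\<Sum>i<m. X (xs ! Suc i))"
      by (rule sum.cong) (auto simp: m)
    also have "(\<Sum>i<m. X (xs ! Suc i)) + X (xs ! 0) = (\<Sum>i<n. X (xs ! i))"
      unfolding m sum.lessThan_Suc_shift by (simp add: add.commute)
    finally show ?thesis .
  qed
  finally show False using 1 by simp
qed

text \<open>A path with distinct vertices avoiding \<open>e\<close> is closed up by
  \<open>e\<close>; distinct vertices also make the chosen edges distinct.\<close>

lemma cycle_of_connected_ends:
  assumes "F \<subseteq> E" "e \<in> F" "en e = {x, y}" and reach: "(adjacent (sub (F - {e})))\<^sup>*\<^sup>* x y"
  shows "\<exists>xs es. is_cycle (sub F) xs es"
proof -
  have xy: "x \<noteq> y" "x \<in> V" "y \<in> V"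
    using card_en[of e] en_subset[of e] assms by auto
  obtain xs where xs: "xs \<noteq> []" "hd xs = x" "last xs = y" "distinct xs"
    "\<And>i. Suc i < length xs \<Longrightarrow> adjacent (sub (F - {e})) (xs ! i) (xs ! Suc i)"
    using rtranclp_distinct_path[OF reach] by blast
  obtain m where m: "length xs = Suc m" using xs(1) by (cases xs) auto
  have ends: "xs ! 0 = x" "xs ! m = y"
    using xs m by (auto simp: hd_conv_nth last_conv_nth)
  have "\<forall>i<m. \<exists>e'. e' \<in> F - {e} \<and> en e' = {xs ! i, xs ! Suc i}"
    using xs(5) m by (auto simp: adjacent_def)
  then obtain g where g: "\<And>i. i < m \<Longrightarrow> g i \<in> F - {e} \<and> en (g i) = {xs ! i, xs ! Suc i}"
    by metis
  define es where "es = map g [0..<m] @ [e]"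
  have nth_es: "es ! i = (if i < m then g i else e)" if "i < Suc m" for i
    using that by (auto simp: es_def nth_append)
  have inj: "inj_on g {0..<m}"
  proof
    fix i j assume ij: "i \<in> {0..<m}" "j \<in> {0..<m}" "g i = g j"
    then have "{xs ! i, xs ! Suc i} = {xs ! j, xs ! Suc j}" using g[of i] g[of j] by auto
    then show "i = j"
      using ij xs(4) m by (auto simp: doubleton_eq_iff nth_eq_iff_index_eq)
  qed
  have "is_cycle (sub F) xs es"
    unfolding is_cycle_def
  proof (intro conjI allI impI)
    show "distinct es" using inj g by (fastforce simp: es_def distinct_map)
    show "set es \<subseteq> edges (sub F)" using g assms by (auto simp: es_def)
    show "set xs \<subseteq> verts (sub F)"
    proof
      fix z assume "z \<in> set xs"
      then obtain i where i: "i < Suc m" "z = xs ! i" by (auto simp: in_set_conv_nth m)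
      show "z \<in> verts (sub F)"
      proof (cases "i < m")
        case True
        then have "g i \<in> E" "z \<in> en (g i)" using g[of i] i assms by auto
        then show ?thesis using en_subset by auto
      next
        case False
        then show ?thesis using i ends xy by (auto simp: less_Suc_eq)
      qed
    qed
    fix i assume i: "i < length xs"
    show "ends (sub F) (es ! i) = {xs ! i, xs ! (Suc i mod length xs)}"
    proof (cases "i < m")
      case True
      then show ?thesis using g[of i] nth_es[of i] m by simp
    next
      case False
      then have "i = m" using i m by simp
      then show ?thesis using nth_es[of m] m ends assms(3) by (simp add: insert_commute)
    qed
  qed (use xs m in \<open>auto simp: es_def\<close>)
  then show ?thesis by blast
qed

text \<open>In a forest, deleting \<open>e\<close> separates its ends, so the indicator of the
  component of one end is a dual potential of \<open>e\<close>.\<close>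

lemma is_forest_iff_indep:
  assumes "F \<subseteq> E"
  shows "is_forest (sub F) \<longleftrightarrow> indep F"
proof
  assume forest: "is_forest (sub F)"
  have "\<exists>X. dual_on F e X" if e: "e \<in> F" for e
  proof -
    have eE: "e \<in> E" using e assms by auto
    obtain x y where xy: "en e = {x, y}" "x \<noteq> y"
      using card_en[OF eE] by (auto simp: card_2_iff)
    let ?K = "comp (F - {e}) x"
    have "x \<in> ?K" using en_subset[OF eE] xy by (auto simp: comp_def)
    moreover have "y \<notin> ?K"
      using cycle_of_connected_ends[OF assms e xy(1)] forest by (auto simp: comp_def is_forest_def)
    ultimately have "cobd (ind ?K) e = 1" using cobd_doubleton[OF eE xy(1)] by (simp add: ind_def)
    moreover have "constant_along (F - {e}) (ind ?K)" using constant_along_comp assms by blast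
    ultimately have "dual_on F e (ind ?K)" by (auto simp: dual_on_def constant_along_def)
    then show ?thesis by blast
  qed
  then show "indep F" using assms by (auto simp: indep_def)
next
  assume "indep F"
  then show "is_forest (sub F)" using cycle_dependent[OF assms] by (auto simp: is_forest_def)
qed

lemma is_tree_iff_Tree:
  assumes "F \<subseteq> E"
  shows "is_tree (sub F) \<longleftrightarrow> Tree F"
proof -
  have "connected_mgraph (sub F) \<longleftrightarrow> (\<forall>X. constant_along F X \<longrightarrow> (\<forall>x\<in>V. X x = X r))"
  proof
    assume "connected_mgraph (sub F)"
    then show "\<forall>X. constant_along F X \<longrightarrow> (\<forall>x\<in>V. X x = X r)"
      using constant_along_reachable[OF _ assms] root_in_V unfolding connected_mgraph_def by simp
  next
    assume c: "\<forall>X. constant_along F X \<longrightarrow> (\<forall>x\<in>V. X x = X r)"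
    have "(adjacent (sub F))\<^sup>*\<^sup>* x y" if xy: "x \<in> V" "y \<in> V" for x y
    proof -
      have "ind (comp F x) x = ind (comp F x) y"
        using c constant_along_comp[OF assms, of x] xy by metis
      moreover have "x \<in> comp F x" using xy by (simp add: comp_def)
      ultimately show ?thesis by (auto simp: ind_def comp_def split: if_splits)
    qed
    then show "connected_mgraph (sub F)" using root_in_V by (auto simp: connected_mgraph_def)
  qed
  then show ?thesis using is_forest_iff_indep[OF assms] by (auto simp: is_tree_def Tree_def)
qed

lemma components_sub: "components (sub F) = comp F ` V"
  by (simp add: components_def comp_def)

lemma comp_Cut2:
  assumes "Cut2 F W" "x \<in> V"
  shows "comp F x = {y\<in>V. y \<in> W \<longleftrightarrow> x \<in> W}"
proof -
  have FE: "F \<subseteq> E" using assms indep_subset_E by (auto simp: Cut2_def)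
  have "y \<in> W \<longleftrightarrow> x \<in> W" if "y \<in> comp F x" for y
  proof -
    have "ind W x = ind W y"
      using constant_along_reachable[OF _ FE] assms that unfolding Cut2_def comp_def by blast
    then show ?thesis by (cases "x \<in> W"; cases "y \<in> W") (simp_all add: ind_def)
  qed
  moreover have "y \<in> comp F x" if y: "y \<in> V" "y \<in> W \<longleftrightarrow> x \<in> W" for y
  proof -
    obtain c where c: "\<forall>z\<in>V. ind (comp F x) z = ind (comp F x) r + c * ind W z"
      using assms constant_along_comp[OF FE, of x] unfolding Cut2_def by blast
    have "ind W y = ind W x" using y by (simp add: ind_def)
    then have "ind (comp F x) y = ind (comp F x) x" using c y assms(2) by simp
    moreover have "x \<in> comp F x" using assms by (simp add: comp_def)
    ultimately show ?thesis by (simp add: ind_def split: if_splits)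
  qed
  moreover have "comp F x \<subseteq> V" by (auto simp: comp_def)
  ultimately show ?thesis by blast
qed

text \<open>As \<open>r\<close> lies in \<open>P2\<close>, the component \<open>T2\<close> is that
  of the root, which leaves \<open>T1\<close> as \<open>side F\<close>.\<close>

lemma compatible_2forest_iff:
  assumes "F \<subseteq> E" "r \<in> P2"
  shows "is_forest (sub F) \<and> card (components (sub F)) = 2 \<and>
      (\<exists>T1 T2. T1 \<noteq> T2 \<and> components (sub F) = {T1, T2} \<and>
        P1 \<subseteq> T1 \<and> P2 \<inter> T1 = {} \<and> P2 \<subseteq> T2 \<and> P1 \<inter> T2 = {}) \<longleftrightarrow>
    Cut2 F (side F) \<and> P1 \<subseteq> side F \<and> P2 \<subseteq> V - side F"
    (is "?L \<longleftrightarrow> ?R")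
proof
  assume ?L
  then obtain T1 T2 where T: "is_forest (sub F)" "comp F ` V = {T1, T2}"
    "P1 \<subseteq> T1" "P2 \<inter> T1 = {}" "P2 \<subseteq> T2" unfolding components_sub by blast
  obtain t where t: "t \<in> V" "T1 = comp F t" using T(2) by blast
  obtain t' where t': "t' \<in> V" "T2 = comp F t'" using T(2) by blast
  have rT: "r \<in> T2" "r \<notin> T1" using T assms by auto
  have V: "y \<in> T1 \<or> y \<in> T2" if "y \<in> V" for y
  proof -
    have "y \<in> comp F y" using that by (simp add: comp_def)
    moreover have "comp F y \<in> {T1, T2}" using T(2) that by blast
    ultimately show ?thesis by auto
  qed
  have const: "X y = X x" if "constant_along F X" "y \<in> comp F x" for X x y
    using constant_along_reachable[OF that(1) assms(1), of x y] that(2) by (simp add: comp_def)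
  have "Cut2 F T1"
    unfolding Cut2_def
  proof (intro conjI allI impI)
    show "indep F" using T(1) is_forest_iff_indep[OF assms(1)] by simp
    show "T1 \<subseteq> V" "T1 \<noteq> {}" using t by (auto simp: comp_def)
    show "r \<notin> T1" by (rule rT)
    show "constant_along F (ind T1)" using constant_along_comp[OF assms(1)] t by simp
    fix X assume X: "constant_along F X"
    \<comment> \<open>The coefficient is the difference of \<open>X\<close> between representatives
      of the two components.\<close>
    have "X y = X r + (X t + X r) * ind T1 y" if y: "y \<in> V" for y
    proof (cases "y \<in> T1")
      case True
      then have "X y = X t" using const[OF X] t by blast
      then show ?thesis using True by (simp add: ind_def add.commute)
    next
      case False
      then have "X y = X t'" "X r = X t'" using const[OF X] t' V[OF y] rT by blast+
      then show ?thesis using False by (simp add: ind_def)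
    qed
    then show "\<exists>c. \<forall>x\<in>V. X x = X r + c * ind T1 x" by blast
  qed
  moreover from this have "side F = T1" by (rule Cut2_side)
  moreover have "T2 \<subseteq> V" using t' by (auto simp: comp_def)
  ultimately show ?R using T by auto
next
  assume R: ?R
  let ?W = "side F"
  have W: "?W \<subseteq> V" "?W \<noteq> {}" "r \<notin> ?W" "indep F" using R by (auto simp: Cut2_def)
  have eq: "comp F x = (if x \<in> ?W then ?W else V - ?W)" if "x \<in> V" for x
    using comp_Cut2[of F ?W x] R that W by auto
  have "comp F ` V = {?W, V - ?W}"
  proof (intro equalityI subsetI)
    fix K assume K: "K \<in> {?W, V - ?W}"
    obtain x where x: "x \<in> ?W" "x \<in> V" using W by blast
    have "comp F x = ?W" "comp F r = V - ?W" using eq[of x] eq[of r] x W root_in_V by auto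
    then show "K \<in> comp F ` V" using K x root_in_V by blast
  qed (use eq in auto)
  moreover have "?W \<noteq> V - ?W" using W root_in_V by blast
  ultimately show ?L
    using R W is_forest_iff_indep[OF assms(1)] unfolding components_sub
    by (intro conjI exI[of _ ?W] exI[of _ "V - ?W"]) auto
qed

lemma edge_bipartitions_eq:
  assumes "r \<in> P2" "P1 \<inter> P2 = {}" "P1 \<union> P2 \<subseteq> V"
  shows "edge_bipartitions (sub E) P1 P2 =
    (\<lambda>\<phi>. (E - \<phi>, \<phi>)) ` {\<phi>\<in>Conf. side \<phi> \<inter> (P1 \<union> P2) = P1}"
proof -
  have sp: "spanning_subgraph (sub E) F = sub F" for F by (simp add: spanning_subgraph_def)
  have P: "P1 \<subseteq> side \<phi> \<and> P2 \<subseteq> V - side \<phi> \<longleftrightarrow> side \<phi> \<inter> (P1 \<union> P2) = P1" for \<phi>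
    using assms by blast
  have "(\<psi>, \<phi>) \<in> edge_bipartitions (sub E) P1 P2 \<longleftrightarrow>
      \<psi> = E - \<phi> \<and> \<phi> \<in> Conf \<and> side \<phi> \<inter> (P1 \<union> P2) = P1" for \<psi> \<phi>
  proof (cases "\<phi> \<subseteq> E \<and> \<psi> = E - \<phi>")
    case True
    have "(\<psi>, \<phi>) \<in> edge_bipartitions (sub E) P1 P2 \<longleftrightarrow> Tree (E - \<phi>) \<and>
        (Cut2 \<phi> (side \<phi>) \<and> P1 \<subseteq> side \<phi> \<and> P2 \<subseteq> V - side \<phi>)"
      unfolding edge_bipartitions_def spanning_tree_def spanning_2forest_def compatible_def sp
        compatible_2forest_iff[OF conjunct1[OF True] assms(1), symmetric]
      using True is_tree_iff_Tree[of "E - \<phi>"] by auto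
    then show ?thesis using True P by (auto simp: Conf_def)
  next
    case False
    then show ?thesis by (auto simp: edge_bipartitions_def Conf_def)
  qed
  then show ?thesis by auto
qed

end

subsection \<open>Deleting two adjacent vertices of a 4-regular graph\<close>

text \<open>Enumerate \<open>A\<close> and swap the positions \<open>2 * j\<close> and
  \<open>2 * j + 1\<close>; evenness gives the last position a partner.\<close>

lemma fixed_point_free_involution_exists:
  assumes "finite A" "even (card A)"
  shows "\<exists>\<iota>. fixed_point_free_involution_on A \<iota>"
proof -
  obtain h where h: "bij_betw h {0..<card A} A"
    using ex_bij_betw_nat_finite[OF assms(1)] by blast
  define t :: "nat \<Rightarrow> nat" where "t i = (if even i then Suc i else i - 1)" for i
  have t: "t i \<in> {0..<card A}" "t (t i) = i" "t i \<noteq> i" if i: "i \<in> {0..<card A}" for i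
  proof -
    have "Suc i \<noteq> card A" if "even i" using that assms(2) by (metis even_Suc)
    then show "t i \<in> {0..<card A}" using i by (auto simp: t_def)
    show "t (t i) = i" "t i \<noteq> i" by (auto simp: t_def elim: oddE)
  qed
  define g where "g = the_inv_into {0..<card A} h"
  have g: "g a \<in> {0..<card A}" "h (g a) = a" if "a \<in> A" for a
    using bij_betwE[OF bij_betw_the_inv_into[OF h]] f_the_inv_into_f_bij_betw[OF h] that
    by (auto simp: g_def)
  have gh: "g (h i) = i" if "i \<in> {0..<card A}" for i
    using h that by (auto simp: g_def bij_betw_def the_inv_into_f_f)
  have hA: "h i \<in> A" if "i \<in> {0..<card A}" for i using h that by (auto simp: bij_betw_def)
  have "fixed_point_free_involution_on A (\<lambda>a. h (t (g a)))"
    unfolding fixed_point_free_involution_on_def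
  proof (intro ballI conjI)
    fix a assume a: "a \<in> A"
    note i = g(1)[OF a]
    show "h (t (g a)) \<in> A" using hA t(1)[OF i] by blast
    show "h (t (g (h (t (g a))))) = a" using gh[OF t(1)[OF i]] t(2)[OF i] g(2)[OF a] by simp
    show "h (t (g a)) \<noteq> a" using gh[OF t(1)[OF i]] t(3)[OF i] by metis
  qed
  then show ?thesis by blast
qed

text \<open>There are as many incident edges as neighbours and every neighbour is reached, so the
  end map is injective on them: no parallel edges at \<open>w\<close>.\<close>

lemma card_edges_to_neighbour:
  assumes "is_mgraph G" "finite (neighbours G w)" "vdegree G w = card (neighbours G w)" "w \<notin> neighbours G w"
  shows "card {e\<in>edges G. ends G e = {w, x}} = of_bool (x \<in> neighbours G w)"
proof -
  let ?A = "{e\<in>edges G. w \<in> ends G e}"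
  have noloop: "{e\<in>edges G. ends G e = {w}} = {}"
    using assms(4) by (auto simp: neighbours_def adjacent_def)
  have two: "\<exists>y. ends G e = {w, y}" if "e \<in> ?A" for e
  proof -
    have "card (ends G e) = 1 \<or> card (ends G e) = 2" using that assms(1) by (auto simp: is_mgraph_def)
    then show ?thesis using that by (auto simp: card_2_iff card_1_singleton_iff)
  qed
  have im: "ends G ` ?A = (\<lambda>y. {w, y}) ` neighbours G w"
  proof (intro equalityI subsetI)
    fix X assume "X \<in> ends G ` ?A"
    then obtain e y where "e \<in> edges G" "X = ends G e" "ends G e = {w, y}" using two by blast
    then show "X \<in> (\<lambda>y. {w, y}) ` neighbours G w" by (auto simp: neighbours_def adjacent_def)
  next
    fix X assume "X \<in> (\<lambda>y. {w, y}) ` neighbours G w"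
    then obtain y where y: "y \<in> neighbours G w" "X = {w, y}" by blast
    then obtain e where "e \<in> edges G" "ends G e = {w, y}" by (auto simp: neighbours_def adjacent_def)
    then show "X \<in> ends G ` ?A" using y by (intro image_eqI[of _ _ e]) auto
  qed
  have "inj_on (\<lambda>y. {w, y}) (neighbours G w)"
    by (auto simp: inj_on_def doubleton_eq_iff)
  then have "card (ends G ` ?A) = card (neighbours G w)"
    unfolding im by (rule card_image)
  moreover have "card ?A = card (neighbours G w)"
    using assms(3) noloop by (simp add: vdegree_def)
  moreover have "finite ?A" using assms(1) by (auto simp: is_mgraph_def)
  ultimately have inj: "inj_on (ends G) ?A" by (intro eq_card_imp_inj_on) auto
  show ?thesis
  proof (cases "x \<in> neighbours G w")
    case True
    then obtain e where e: "e \<in> edges G" "ends G e = {w, x}" by (auto simp: neighbours_def adjacent_def)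
    then have "{e'\<in>edges G. ends G e' = {w, x}} = {e}"
      using inj by (auto simp: inj_on_def)
    then show ?thesis using True by simp
  next
    case False
    then have "{e'\<in>edges G. ends G e' = {w, x}} = {}" by (auto simp: neighbours_def adjacent_def)
    then show ?thesis using False by (simp only: card.empty) simp
  qed
qed

lemma edge_bipartitions_commute: "edge_bipartitions R P1 P2 = edge_bipartitions R P2 P1"
proof -
  have "compatible R F P1 P2 \<Longrightarrow> compatible R F P2 P1" for F P1 P2
    unfolding compatible_def by (metis insert_commute)
  then have "compatible R F P1 P2 = compatible R F P2 P1" for F by blast
  then show ?thesis by (simp add: edge_bipartitions_def)
qed

text \<open>Isolates the degenerate cases: distinctness of \<open>a\<close> to \<open>f\<close> does
  not separate them from \<open>v\<close> and \<open>w\<close>, and \<open>R\<close> might have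
  loops. Either way all six classes are empty.\<close>

lemma edge_bipartitions_nonempty:
  assumes "edge_bipartitions R P1 P2 \<noteq> {}"
  shows "P1 \<union> P2 \<subseteq> verts R" "e \<in> edges R \<Longrightarrow> x \<in> verts R \<Longrightarrow> ends R e \<noteq> {x}"
proof -
  obtain \<psi> \<phi> where *: "\<psi> \<union> \<phi> = edges R" "is_forest (spanning_subgraph R \<psi>)"
    "is_forest (spanning_subgraph R \<phi>)" "compatible R \<phi> P1 P2"
    using assms by (auto simp: edge_bipartitions_def spanning_tree_def spanning_2forest_def is_tree_def)
  have "T \<subseteq> verts R" if "T \<in> components (spanning_subgraph R \<phi>)" for T
    using that by (auto simp: components_def spanning_subgraph_def)
  then show "P1 \<union> P2 \<subseteq> verts R" using *(4) unfolding compatible_def by blast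
  have loop: "\<not> is_forest (spanning_subgraph R F)" if "e \<in> F" "ends R e = {x}" "x \<in> verts R" for F e x
  proof -
    have "is_cycle (spanning_subgraph R F) [x] [e]"
      using that by (simp add: is_cycle_def spanning_subgraph_def)
    then show ?thesis unfolding is_forest_def by blast
  qed
  show "ends R e \<noteq> {x}" if "e \<in> edges R" "x \<in> verts R"
    using loop[of e _ x] that *(1-3) by blast
qed

lemma four_regular_minus_edge_delete_verts:
  assumes G: "is_mgraph G" "regular_mgraph 4 G" "v \<in> verts G" "w \<in> verts G"
    and nw: "neighbours G w = {v, a, b, c}" and nv: "neighbours G v = {w, d, e, f}"
    and dist: "distinct [a, b, c, d, e, f]" and R: "R = delete_verts G {v, w}"
    and S: "{a, b, c, d, e, f} \<subseteq> verts R"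
    and noloop: "\<And>e x. e \<in> edges R \<Longrightarrow> x \<in> verts R \<Longrightarrow> ends R e \<noteq> {x}"
  shows "four_regular_minus_edge (verts R) (edges R) (ends R) f {a, b, c, d, e, f}"
proof -
  have VR: "verts R = verts G - {v, w}" and ER: "edges R = {e\<in>edges G. ends G e \<inter> {v, w} = {}}"
    and enR: "ends R = ends G" by (auto simp: R delete_verts_def)
  have ne: "{a, b, c, d, e, f} \<inter> {v, w} = {}" using S VR by auto
  have vw: "v \<noteq> w"
  proof
    assume "v = w"
    then have "{v, a, b, c} = {v, d, e, f}" using nw nv by simp
    then have "a \<in> {v, d, e, f}" by blast
    then show False using dist ne by auto
  qed
  have sub: "ends G g \<subseteq> verts G" "card (ends G g) = 1 \<or> card (ends G g) = 2" if "g \<in> edges G" for g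
    using G(1) that by (auto simp: is_mgraph_def)
  have sub': "ends R g \<subseteq> verts R" if "g \<in> edges R" for g
    using sub(1)[of g] that by (auto simp: VR ER enR)
  have cw: "card {g\<in>edges G. ends G g = {w, x}} = of_bool (x \<in> {v, a, b, c})" for x
  proof -
    have "card {v, a, b, c} = 4" "w \<notin> {v, a, b, c}" using dist ne vw by auto
    moreover have "vdegree G w = 4" using G by (simp add: regular_mgraph_def)
    ultimately show ?thesis using card_edges_to_neighbour[OF G(1), of w x] nw by simp
  qed
  have cv: "card {g\<in>edges G. ends G g = {v, x}} = of_bool (x \<in> {w, d, e, f})" for x
  proof -
    have "card {w, d, e, f} = 4" "v \<notin> {w, d, e, f}" using dist ne vw by auto
    moreover have "vdegree G v = 4" using G by (simp add: regular_mgraph_def)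
    ultimately show ?thesis using card_edges_to_neighbour[OF G(1), of v x] nv by simp
  qed
  have finE: "finite (edges G)" using G(1) by (simp add: is_mgraph_def)
  have deg: "card {g\<in>edges R. x \<in> ends R g} + of_bool (x \<in> {a, b, c, d, e, f}) = 4"
    if x: "x \<in> verts R" for x
  proof -
    have xvw: "x \<noteq> v" "x \<noteq> w" "x \<in> verts G" using x VR by auto
    let ?A = "{g\<in>edges R. x \<in> ends R g}" and ?B = "{g\<in>edges G. ends G g = {w, x}}"
      and ?C = "{g\<in>edges G. ends G g = {v, x}}"
    have "ends G g \<noteq> {x}" if "g \<in> edges G" for g
    proof
      assume "ends G g = {x}"
      moreover from this have "g \<in> edges R" using that xvw by (simp add: ER)
      ultimately show False using noloop[OF _ x, of g] enR by simp
    qed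
    then have nl: "{g\<in>edges G. ends G g = {x}} = {}" by blast
    have "ends G g = {w, x} \<or> ends G g = {v, x}"
      if g: "g \<in> edges G" "x \<in> ends G g" "g \<notin> edges R" for g
    proof -
      have vw': "v \<in> ends G g \<or> w \<in> ends G g" using g by (auto simp: ER)
      have "card (ends G g) = 1 \<or> card (ends G g) = 2" by (rule sub(2)[OF g(1)])
      then obtain y z where "ends G g = {y, z}" by (auto simp: card_2_iff card_1_singleton_iff)
      then show ?thesis using vw' g(2) xvw by auto
    qed
    \<comment> \<open>Edges at \<open>x\<close> either survive in \<open>R\<close> or lead to
      \<open>w\<close> or to \<open>v\<close>; the last two kinds number at most one in total, as
      the neighbour sets are disjoint.\<close>
    then have "{g\<in>edges G. x \<in> ends G g} = ?A \<union> (?B \<union> ?C)"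
      by (auto simp: ER enR)
    moreover have "card (?A \<union> (?B \<union> ?C)) = card ?A + card (?B \<union> ?C)"
      by (rule card_Un_disjoint) (use finE in \<open>auto simp: ER enR\<close>)
    moreover have "card (?B \<union> ?C) = card ?B + card ?C"
      by (rule card_Un_disjoint) (use finE vw xvw in \<open>auto simp: doubleton_eq_iff\<close>)
    moreover have "card {g\<in>edges G. x \<in> ends G g} = 4"
    proof -
      have "vdegree G x = 4" using G xvw by (simp add: regular_mgraph_def)
      then show ?thesis unfolding vdegree_def nl by simp
    qed
    ultimately have "card ?A + (of_bool (x \<in> {v, a, b, c}) + of_bool (x \<in> {w, d, e, f})) = 4"
      unfolding cv cw by (simp only:)
    moreover have "of_bool (x \<in> {v, a, b, c}) + of_bool (x \<in> {w, d, e, f}) =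
        (of_bool (x \<in> {a, b, c, d, e, f}) :: nat)"
    proof -
      have 1: "x \<in> {v, a, b, c} \<longleftrightarrow> x \<in> {a, b, c}" and 2: "x \<in> {w, d, e, f} \<longleftrightarrow> x \<in> {d, e, f}"
        and 3: "x \<in> {a, b, c, d, e, f} \<longleftrightarrow> x \<in> {a, b, c} \<or> x \<in> {d, e, f}"
        using xvw by simp_all
      have "{a, b, c} \<inter> {d, e, f} = {}" using dist by simp
      then have disj: "\<not> (x \<in> {a, b, c} \<and> x \<in> {d, e, f})" by blast
      have "of_bool p + of_bool q = (of_bool (p \<or> q) :: nat)" if "\<not> (p \<and> q)" for p q
        using that by auto
      from this[OF disj] show ?thesis unfolding 1 2 3 .
    qed
    ultimately show ?thesis by (simp only:)
  qed
  show ?thesis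
  proof
    show "finite (verts R)" "finite (edges R)" using G(1) by (auto simp: is_mgraph_def VR ER)
    show "ends R g \<subseteq> verts R" if "g \<in> edges R" for g by (rule sub'[OF that])
    show "card (ends R g) = 2" if g: "g \<in> edges R" for g
    proof -
      have "card (ends R g) = 1 \<or> card (ends R g) = 2" using sub(2) g by (auto simp: ER enR)
      moreover have "card (ends R g) \<noteq> 1"
        using noloop[OF g] sub'[OF g] by (auto simp: card_1_singleton_iff)
      ultimately show ?thesis by blast
    qed
    show "f \<in> verts R" "{a, b, c, d, e, f} \<subseteq> verts R" "f \<in> {a, b, c, d, e, f}" using S by auto
    show "card {a, b, c, d, e, f} = 6" using dist by simp
  qed (rule deg)
qed

text \<open>Sides avoid the root \<open>f\<close>, so the bipartition isolating \<open>f\<close>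
  appears through its five-element part.\<close>

lemma singleton_or_all_iff:
  assumes "distinct [a, b, c, d, e, f]" "X \<subseteq> {a, b, c, d, e, f}" "f \<notin> X"
  shows "card X = 1 \<or> card X = 5 \<longleftrightarrow> X \<in> {{a}, {b}, {c}, {d}, {e}, {a, b, c, d, e}}"
proof
  assume "card X = 1 \<or> card X = 5"
  then show "X \<in> {{a}, {b}, {c}, {d}, {e}, {a, b, c, d, e}}"
  proof
    assume "card X = 1"
    then show ?thesis using assms(2,3) by (auto simp: card_1_singleton_iff)
  next
    assume "card X = 5"
    moreover have "X \<subseteq> {a, b, c, d, e}" using assms by auto
    moreover have "card {a, b, c, d, e} = 5" using assms by simp
    ultimately have "X = {a, b, c, d, e}" by (intro card_subset_eq) auto
    then show ?thesis by simp
  qed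
qed (use assms(1) in auto)

theorem theorem5p8:
  fixes G R :: "('v, 'e) mgraph" and v w a b c d e f :: 'v
  assumes "is_mgraph G" and "connected_mgraph G" and "regular_mgraph 4 G"
    and "v \<in> verts G" and "w \<in> verts G" and "adjacent G v w"
    and "neighbours G w = {v, a, b, c}"
    and "neighbours G v = {w, d, e, f}"
    and "distinct [a, b, c, d, e, f]"
    and "R = delete_verts G {v, w}"
  shows "(\<exists>\<iota>. fixed_point_free_involution_on
            (edge_bipartitions R {a} {b, c, d, e, f} \<union> edge_bipartitions R {b} {a, c, d, e, f} \<union>
             edge_bipartitions R {c} {a, b, d, e, f} \<union> edge_bipartitions R {d} {a, b, c, e, f} \<union>
             edge_bipartitions R {e} {a, b, c, d, f} \<union> edge_bipartitions R {f} {a, b, c, d, e}) \<iota>) \<and>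
         [num_edge_bipartitions R {a} {b, c, d, e, f} + num_edge_bipartitions R {b} {a, c, d, e, f} +
          num_edge_bipartitions R {c} {a, b, d, e, f} + num_edge_bipartitions R {d} {a, b, c, e, f} +
          num_edge_bipartitions R {e} {a, b, c, d, f} + num_edge_bipartitions R {f} {a, b, c, d, e} = 0]
         (mod 2)"
proof (cases "{a, b, c, d, e, f} \<subseteq> verts R \<and> (\<forall>g\<in>edges R. \<forall>x\<in>verts R. ends R g \<noteq> {x})")
  case False
  have empty: "edge_bipartitions R P1 P2 = {}" if P: "P1 \<union> P2 = {a, b, c, d, e, f}" for P1 P2
    using edge_bipartitions_nonempty[of R P1 P2] False P by metis
  have
    "edge_bipartitions R {a} {b, c, d, e, f} = {}" "edge_bipartitions R {b} {a, c, d, e, f} = {}"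
    "edge_bipartitions R {c} {a, b, d, e, f} = {}" "edge_bipartitions R {d} {a, b, c, e, f} = {}"
    "edge_bipartitions R {e} {a, b, c, d, f} = {}" "edge_bipartitions R {f} {a, b, c, d, e} = {}"
    by (rule empty; blast)+
  then show ?thesis
    by (simp add: num_edge_bipartitions_def fixed_point_free_involution_on_def)
next
  case True
  define S where "S = {a, b, c, d, e, f}"
  interpret four_regular_minus_edge "verts R" "edges R" "ends R" f S
    unfolding S_def
    by (rule four_regular_minus_edge_delete_verts[OF assms(1,3,4,5,7-10)]) (use True in auto)
  define Q where "Q P = {\<phi>\<in>Conf. side \<phi> \<inter> S = P}" for P
  let ?g = "\<lambda>\<phi>. (edges R - \<phi>, \<phi>)"
  have R_eq: "sub (edges R) = R" by simp
  have B: "edge_bipartitions R P1 P2 = ?g ` Q P1" if "f \<in> P2" "P1 \<inter> P2 = {}" "P1 \<union> P2 = S" for P1 P2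
    using edge_bipartitions_eq[of P2 P1] that S_subset unfolding R_eq Q_def by simp
  let ?A = "{a, b, c, d, e}"
  have sets:
    "edge_bipartitions R {a} {b, c, d, e, f} = ?g ` Q {a}"
    "edge_bipartitions R {b} {a, c, d, e, f} = ?g ` Q {b}"
    "edge_bipartitions R {c} {a, b, d, e, f} = ?g ` Q {c}"
    "edge_bipartitions R {d} {a, b, c, e, f} = ?g ` Q {d}"
    "edge_bipartitions R {e} {a, b, c, d, f} = ?g ` Q {e}"
    "edge_bipartitions R {f} {a, b, c, d, e} = ?g ` Q ?A"
    \<comment> \<open>The last class is flipped so that the root is in its second part, as in the
      others.\<close>
    unfolding edge_bipartitions_commute[of R "{f}" ?A]
    by (rule B; use assms(9) in \<open>auto simp: S_def\<close>)+
  let ?P = "{{a}, {b}, {c}, {d}, {e}, ?A}"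
  have card_g: "card (?g ` Q P) = card (Q P)" for P
    by (rule card_image) (auto simp: inj_on_def)
  have finQ: "finite (Q P)" for P using finite_Conf by (simp add: Q_def)
  have "(\<Union>P\<in>?P. Q P) = {\<phi>\<in>Conf. card (side \<phi> \<inter> S) = 1 \<or> card (side \<phi> \<inter> S) = 5}"
  proof -
    have "f \<notin> side \<phi>" for \<phi> by (simp add: side_def)
    then have "card (side \<phi> \<inter> S) = 1 \<or> card (side \<phi> \<inter> S) = 5 \<longleftrightarrow> side \<phi> \<inter> S \<in> ?P" for \<phi>
      using singleton_or_all_iff[OF assms(9), of "side \<phi> \<inter> S"] by (auto simp: S_def)
    then show ?thesis unfolding Q_def by blast
  qed
  then have even: "even (card (\<Union>P\<in>?P. Q P))" using even_card_Conf_1_5 by simp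
  \<comment> \<open>The trace of the side on \<open>S\<close> determines \<open>P\<close>, so the
    classes are disjoint and the sum of the six numbers is the size of the union.\<close>
  have "card (\<Union>P\<in>?P. Q P) = (\<Sum>P\<in>?P. card (Q P))"
    by (rule card_UN_disjoint) (use finQ in \<open>auto simp: Q_def\<close>)
  also have "\<dots> = card (Q {a}) + card (Q {b}) + card (Q {c}) + card (Q {d}) + card (Q {e}) + card (Q ?A)"
  proof -
    have "{a} \<noteq> ?A" "{b} \<noteq> ?A" "{c} \<noteq> ?A" "{d} \<noteq> ?A" "{e} \<noteq> ?A" using assms(9) by auto
    then show ?thesis using assms(9) by simp
  qed
  finally have sum: "even (card (Q {a}) + card (Q {b}) + card (Q {c}) + card (Q {d}) + card (Q {e}) + card (Q ?A))"
    using even by simp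
  have union: "?g ` Q {a} \<union> ?g ` Q {b} \<union> ?g ` Q {c} \<union> ?g ` Q {d} \<union> ?g ` Q {e} \<union> ?g ` Q ?A =
      ?g ` (\<Union>P\<in>?P. Q P)"
    by (simp only: UN_insert UN_empty image_Un Un_empty_right Un_assoc)
  have "card (?g ` (\<Union>P\<in>?P. Q P)) = card (\<Union>P\<in>?P. Q P)"
    by (rule card_image) (rule inj_onI, simp)
  then have "\<exists>\<iota>. fixed_point_free_involution_on (?g ` (\<Union>P\<in>?P. Q P)) \<iota>"
    using even finQ by (intro fixed_point_free_involution_exists) (simp only: finite_imageI finite_UN_I finite.intros, simp only:)
  then show ?thesis
    unfolding sets union num_edge_bipartitions_def card_g using sum by (simp add: cong_0_iff)
qed

end
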